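(* Let $R=D[X_1,\dots,X_n]$ be the polynomial ring in $n\ge2$ indeterminates over a domain $D$, and suppose that $\mathcal I(R)$ is a BF-monoid. \begin{enumerate} \item $\mathcal I(R)$ is neither transfer Krull nor locally finitely generated. Moreover, if $D^\times$ is infinite, then $\mathcal I(R)$ is not an FF-monoid. \item $\mathcal U_k(\mathcal I(R))=\mathbb N_{\ge2}$ for all $k\ge2$. \item $\mathsf L_{\mathcal I(R)}(\langle X_1,X_2\rangle^k)=[2,k]=\{2,3,\dots,k\}$ for all $k\ge2$. \item $\mathcal I(R)$ is fully elastic. \end{enumerate}
   Context: $\mathcal I(R)$ is the semigroup of nonzero ideals of $R$ under ideal multiplication. Monoids are commutative, unit-cancellative (if $a=au$ then $u$ is a unit), with identity. Atom: non-unit $u$ with $u=ab\Rightarrow a$ or $b$ a unit. $\mathsf L(a)$: set of $\ell\in\mathbb N_0$ with $a=\varepsilon u_1\cdots u_\ell$, $\varepsilon$ a unit, $u_i$ atoms; $\mathcal L(H)=\{\mathsf L(a)\}$. BF-monoid: every $\mathsf L(a)$ finite nonempty. FF-monoid: every $a$ has only finitely many factorizations into atoms up to order and units (equivalently, in an atomic setting, finitely many distinct factorizations in the reduced monoid). Locally finitely generated: for each $a$, the divisor-closed submonoid generated by $a$ (all divisors of powers of $a$) modulo units is finitely generated. $\mathcal U_k(H)$: union of all $L\in\mathcal L(H)$ with $k\in L$. $\rho(L)=\max L/\min L$, $\rho(\{0\})=1$, $\rho(H)=\sup\rho(L)$; fully elastic: every rational $1<q<\rho(H)$ equals $\rho(L)$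 for some $L\in\mathcal L(H)$. Transfer homomorphism $\theta:H\to B$: (T1) $B=\theta(H)B^\times$, $\theta^{-1}(B^\times)=H^\times$; (T2) if $\theta(u)=bc$ then $u=vw$ with $\theta(v)\in bB^\times$, $\theta(w)\in cB^\times$. Krull monoid: cancellative monoid with a divisor homomorphism ($\varphi(a)\mid\varphi(b)\Rightarrow a\mid b$) into a factorial monoid. Transfer Krull: admits a transfer homomorphism to a Krull monoid. *)

theory Defs
  imports "HOL-Algebra.Divisibility" "HOL-Library.Poly_Mapping" "HOL-Library.Extended_Real"
begin

definition is_ideal :: "'r::comm_ring_1 set \<Rightarrow> bool" where
  "is_ideal I \<longleftrightarrow> 0 \<in> I \<and> (\<forall>x\<in>I. \<forall>y\<in>I. x + y \<in> I) \<and> (\<forall>r. \<forall>x\<in>I. r * x \<in> I)"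

definition gen_ideal :: "'r::comm_ring_1 set \<Rightarrow> 'r set" where
  "gen_ideal S = \<Inter>{K. is_ideal K \<and> S \<subseteq> K}"

definition ideal_prod :: "'r::comm_ring_1 set \<Rightarrow> 'r set \<Rightarrow> 'r set" where
  "ideal_prod I J = gen_ideal {a * b | a b. a \<in> I \<and> b \<in> J}"

definition ideal_monoid :: "('r::comm_ring_1) set monoid" where
  "ideal_monoid = \<lparr>carrier = {I. is_ideal I \<and> I \<noteq> {0}}, mult = ideal_prod, one = UNIV\<rparr>"

text \<open>Polynomial ring D[X_i : i in 'n] (monomials are finitely supported exponent vectors)
  and the indeterminate X_i.\<close>
type_synonym ('n, 'a) mpoly_ring = "('n \<Rightarrow>\<^sub>0 nat) \<Rightarrow>\<^sub>0 'a"

definition var :: "'n \<Rightarrow> ('n, 'a::comm_ring_1) mpoly_ring" where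
  "var i = Poly_Mapping.single (Poly_Mapping.single i 1) 1"

definition mprod :: "('m, 'x) monoid_scheme \<Rightarrow> 'm list \<Rightarrow> 'm" where
  "mprod G us = foldr (\<otimes>\<^bsub>G\<^esub>) us \<one>\<^bsub>G\<^esub>"

definition atom :: "('m, 'x) monoid_scheme \<Rightarrow> 'm \<Rightarrow> bool" where
  "atom G u \<longleftrightarrow> u \<in> carrier G \<and> u \<notin> Units G \<and>
     (\<forall>a\<in>carrier G. \<forall>b\<in>carrier G. u = a \<otimes>\<^bsub>G\<^esub> b \<longrightarrow> a \<in> Units G \<or> b \<in> Units G)"

definition lengths :: "('m, 'x) monoid_scheme \<Rightarrow> 'm \<Rightarrow> nat set" where
  "lengths G a = {length us | us. set us \<subseteq> {u. atom G u} \<and>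
                   (\<exists>\<epsilon>\<in>Units G. a = \<epsilon> \<otimes>\<^bsub>G\<^esub> mprod G us)}"

definition system_of_lengths :: "('m, 'x) monoid_scheme \<Rightarrow> nat set set" where
  "system_of_lengths G = lengths G ` carrier G"

definition BF_monoid :: "('m, 'x) monoid_scheme \<Rightarrow> bool" where
  "BF_monoid G \<longleftrightarrow> (\<forall>a\<in>carrier G. finite (lengths G a) \<and> lengths G a \<noteq> {})"

definition assoc_class :: "('m, 'x) monoid_scheme \<Rightarrow> 'm \<Rightarrow> 'm set" where
  "assoc_class G u = {v \<in> carrier G. \<exists>\<epsilon>\<in>Units G. v = u \<otimes>\<^bsub>G\<^esub> \<epsilon>}"

definition factorizations :: "('m, 'x) monoid_scheme \<Rightarrow> 'm \<Rightarrow> 'm set multiset set" where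
  "factorizations G a = {mset (map (assoc_class G) us) | us. set us \<subseteq> {u. atom G u} \<and>
                   (\<exists>\<epsilon>\<in>Units G. a = \<epsilon> \<otimes>\<^bsub>G\<^esub> mprod G us)}"

definition FF_monoid :: "('m, 'x) monoid_scheme \<Rightarrow> bool" where
  "FF_monoid G \<longleftrightarrow> (\<forall>a\<in>carrier G. finite (factorizations G a) \<and> factorizations G a \<noteq> {})"

definition divisor_closed_gen :: "('m, 'x) monoid_scheme \<Rightarrow> 'm \<Rightarrow> 'm set" where
  "divisor_closed_gen G a = {b \<in> carrier G. \<exists>n::nat. b divides\<^bsub>G\<^esub> (a [^]\<^bsub>G\<^esub> n)}"

text \<open>[[a]] modulo units is finitely generated: finitely many elements of [[a]] such that
  every element of [[a]] is a unit times a product of them.\<close>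
definition locally_finitely_generated :: "('m, 'x) monoid_scheme \<Rightarrow> bool" where
  "locally_finitely_generated G \<longleftrightarrow>
     (\<forall>a\<in>carrier G. \<exists>E. finite E \<and> E \<subseteq> divisor_closed_gen G a \<and>
        (\<forall>b\<in>divisor_closed_gen G a. \<exists>es \<epsilon>. set es \<subseteq> E \<and> \<epsilon> \<in> Units G \<and>
                                        b = \<epsilon> \<otimes>\<^bsub>G\<^esub> mprod G es))"

definition union_of_sets_of_lengths :: "('m, 'x) monoid_scheme \<Rightarrow> nat \<Rightarrow> nat set" where
  "union_of_sets_of_lengths G k = \<Union>{L \<in> system_of_lengths G. k \<in> L}"

definition elasticity_set :: "nat set \<Rightarrow> real" where
  "elasticity_set L = (if L = {0} then 1 else real (Max L) / real (Min L))"

definition elasticity :: "('m, 'x) monoid_scheme \<Rightarrow> ereal" where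
  "elasticity G = (SUP L\<in>system_of_lengths G. ereal (elasticity_set L))"

definition fully_elastic :: "('m, 'x) monoid_scheme \<Rightarrow> bool" where
  "fully_elastic G \<longleftrightarrow> (\<forall>q::rat. 1 < q \<and> ereal (real_of_rat q) < elasticity G \<longrightarrow>
      (\<exists>L\<in>system_of_lengths G. elasticity_set L = real_of_rat q))"

definition monoid_hom :: "('m, 'x) monoid_scheme \<Rightarrow> ('b, 'y) monoid_scheme \<Rightarrow> ('m \<Rightarrow> 'b) \<Rightarrow> bool" where
  "monoid_hom G B \<theta> \<longleftrightarrow> \<theta> \<in> carrier G \<rightarrow> carrier B \<and> \<theta> \<one>\<^bsub>G\<^esub> = \<one>\<^bsub>B\<^esub> \<and>
     (\<forall>a\<in>carrier G. \<forall>b\<in>carrier G. \<theta> (a \<otimes>\<^bsub>G\<^esub> b) = \<theta> a \<otimes>\<^bsub>B\<^esub> \<theta> b)"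

definition transfer_hom :: "('m, 'x) monoid_scheme \<Rightarrow> ('b, 'y) monoid_scheme \<Rightarrow> ('m \<Rightarrow> 'b) \<Rightarrow> bool" where
  "transfer_hom G B \<theta> \<longleftrightarrow> monoid_hom G B \<theta> \<and>
     carrier B = {\<theta> u \<otimes>\<^bsub>B\<^esub> \<epsilon> | u \<epsilon>. u \<in> carrier G \<and> \<epsilon> \<in> Units B} \<and>
     (\<forall>u\<in>carrier G. \<theta> u \<in> Units B \<longleftrightarrow> u \<in> Units G) \<and>
     (\<forall>u\<in>carrier G. \<forall>b\<in>carrier B. \<forall>c\<in>carrier B. \<theta> u = b \<otimes>\<^bsub>B\<^esub> c \<longrightarrow>
        (\<exists>v\<in>carrier G. \<exists>w\<in>carrier G. u = v \<otimes>\<^bsub>G\<^esub> w \<and>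
           (\<exists>\<epsilon>\<in>Units B. \<theta> v = b \<otimes>\<^bsub>B\<^esub> \<epsilon>) \<and> (\<exists>\<eta>\<in>Units B. \<theta> w = c \<otimes>\<^bsub>B\<^esub> \<eta>)))"

definition krull_monoid_via :: "('b, 'y) monoid_scheme \<Rightarrow> ('c, 'z) monoid_scheme \<Rightarrow> ('b \<Rightarrow> 'c) \<Rightarrow> bool" where
  "krull_monoid_via B F \<phi> \<longleftrightarrow> comm_monoid_cancel B \<and> factorial_monoid F \<and> monoid_hom B F \<phi> \<and>
     (\<forall>a\<in>carrier B. \<forall>b\<in>carrier B. \<phi> a divides\<^bsub>F\<^esub> \<phi> b \<longrightarrow> a divides\<^bsub>B\<^esub> b)"

end

theory Submission
  imports Defs "HOL-Computational_Algebra.Polynomial"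
begin

text \<open>Let \<open>M k\<close> be the $k$-th power of the ideal \<open>\<langle>X, Y\<rangle>\<close> of two of the variables. The BF property makes
  the monoid of ideals unit-cancellative, so every nonunit factor of \<open>M k\<close> is contained in \<open>M 1\<close>, and
  comparing orders bounds the lengths of \<open>M k\<close> by \<open>k\<close>. Conversely \<open>M k\<close> is a product of two atoms
  generated by forms: one is \<open>\<langle>X, Y\<rangle>\<close> or \<open>\<langle>X\<^sup>2 + Y\<^sup>2, XY\<rangle>\<close>, the other is generated by $X^d$ and the
  monomials $X^{d-l} Y^l$ with \<open>l\<close> odd. So the lengths of \<open>M k\<close> are exactly \<open>2, \<dots>, k\<close>, which gives the
  unions of sets of lengths. Multiplying by powers of the cancellative prime \<open>\<langle>Y\<rangle>\<close> shifts sets of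
  lengths, which gives full elasticity. The monomial atoms above, infinitely many in number, divide
  powers of \<open>M 1\<close>; the identity \<open>M 3 = M 1 \<cdot> \<langle>X\<^sup>2 + cY\<^sup>2, XY\<rangle>\<close> for every unit \<open>c\<close> refutes the FF property,
  and with \<open>c = 1\<close> it is incompatible with a transfer homomorphism to a cancellative monoid.\<close>

section \<open>Products of ideals\<close>

lemma is_ideal_gen_ideal: "is_ideal (gen_ideal S)"
  unfolding gen_ideal_def is_ideal_def by blast

lemma gen_ideal_superset: "S \<subseteq> gen_ideal S"
  unfolding gen_ideal_def by blast

lemma gen_ideal_least: "is_ideal K \<Longrightarrow> S \<subseteq> K \<Longrightarrow> gen_ideal S \<subseteq> K"
  unfolding gen_ideal_def by blast

lemma is_ideal_add: "is_ideal I \<Longrightarrow> x \<in> I \<Longrightarrow> y \<in> I \<Longrightarrow> x + y \<in> I"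
  unfolding is_ideal_def by blast

lemma is_ideal_mult: "is_ideal I \<Longrightarrow> x \<in> I \<Longrightarrow> r * x \<in> I"
  unfolding is_ideal_def by blast

lemma is_ideal_zero: "is_ideal I \<Longrightarrow> 0 \<in> I"
  unfolding is_ideal_def by blast

lemma is_ideal_diff:
  assumes "is_ideal I" "x \<in> I" "y \<in> I"
  shows "x - y \<in> I"
  using is_ideal_add[OF assms(1,2) is_ideal_mult[OF assms(1,3), of "-1"]] by simp

lemma is_ideal_sum:
  assumes "is_ideal I" "\<And>x. x \<in> A \<Longrightarrow> f x \<in> I"
  shows "sum f A \<in> I"
  using assms(2) by (induction A rule: infinite_finite_induct)
    (auto intro: is_ideal_add is_ideal_zero assms(1))

lemma is_ideal_UNIV: "is_ideal UNIV"
  unfolding is_ideal_def by simp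

lemma is_ideal_colon: "is_ideal K \<Longrightarrow> is_ideal {z. \<forall>a\<in>S. a * z \<in> K}"
  unfolding is_ideal_def by (simp add: distrib_left mult.left_commute)

lemma is_ideal_prod: "is_ideal (ideal_prod I J)"
  unfolding ideal_prod_def by (rule is_ideal_gen_ideal)

lemma ideal_prod_memI: "a \<in> I \<Longrightarrow> b \<in> J \<Longrightarrow> a * b \<in> ideal_prod I J"
  unfolding ideal_prod_def by (rule subsetD[OF gen_ideal_superset]) blast

lemma ideal_prod_least:
  "is_ideal K \<Longrightarrow> (\<And>a b. a \<in> I \<Longrightarrow> b \<in> J \<Longrightarrow> a * b \<in> K) \<Longrightarrow> ideal_prod I J \<subseteq> K"
  unfolding ideal_prod_def by (rule gen_ideal_least) auto

lemma ideal_prod_commute: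
  fixes I J :: "'a::comm_ring_1 set"
  shows "ideal_prod I J = ideal_prod J I"
proof -
  have "ideal_prod I J \<subseteq> ideal_prod J I" for I J :: "'a set"
    by (rule ideal_prod_least[OF is_ideal_prod]) (subst mult.commute, rule ideal_prod_memI)
  thus ?thesis by (intro subset_antisym)
qed

lemma ideal_prod_subset_right: "is_ideal J \<Longrightarrow> ideal_prod I J \<subseteq> J"
  by (rule ideal_prod_least) (auto intro: is_ideal_mult)

lemma ideal_prod_subset_left: "is_ideal I \<Longrightarrow> ideal_prod I J \<subseteq> I"
  unfolding ideal_prod_commute[of I J] by (rule ideal_prod_subset_right)

lemma ideal_prod_UNIV: "is_ideal J \<Longrightarrow> ideal_prod UNIV J = J"
  using ideal_prod_subset_right[of J UNIV] ideal_prod_memI[of 1 UNIV _ J] by auto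

lemma ideal_prod_mono: "I \<subseteq> I' \<Longrightarrow> J \<subseteq> J' \<Longrightarrow> ideal_prod I J \<subseteq> ideal_prod I' J'"
  by (rule ideal_prod_least) (auto intro: is_ideal_prod ideal_prod_memI)

text \<open>The elements \<open>z\<close> with \<open>a * z\<close> in the target for all
  \<open>a\<close> in \<open>I\<close> form an ideal, so it is enough to test products of elements
  of \<open>J\<close> and \<open>K\<close>.\<close>

lemma ideal_prod_assoc_subset:
  "ideal_prod I (ideal_prod J K) \<subseteq> ideal_prod (ideal_prod I J) K"
proof (rule ideal_prod_least[OF is_ideal_prod])
  fix a z assume a: "a \<in> I" and z: "z \<in> ideal_prod J K"
  have "ideal_prod J K \<subseteq> {z. \<forall>a\<in>I. a * z \<in> ideal_prod (ideal_prod I J) K}"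
    by (rule ideal_prod_least[OF is_ideal_colon[OF is_ideal_prod]])
      (auto simp: mult.assoc[symmetric] intro!: ideal_prod_memI)
  thus "a * z \<in> ideal_prod (ideal_prod I J) K" using a z by blast
qed

lemma ideal_prod_assoc: "ideal_prod (ideal_prod I J) K = ideal_prod I (ideal_prod J K)"
proof (rule antisym)
  \<comment> \<open>Exchanging \<open>I\<close> and \<open>K\<close> and commuting all products
    turns one inclusion into the other.\<close>
  have "ideal_prod K (ideal_prod J I) \<subseteq> ideal_prod (ideal_prod K J) I"
    by (rule ideal_prod_assoc_subset)
  thus "ideal_prod (ideal_prod I J) K \<subseteq> ideal_prod I (ideal_prod J K)"
    unfolding ideal_prod_commute[of K] ideal_prod_commute[of J I]
      ideal_prod_commute[of "ideal_prod J K" I] .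
qed (rule ideal_prod_assoc_subset)

section \<open>The reduced commutative monoid of nonzero ideals\<close>

lemma carrier_ideal_monoid: "I \<in> carrier ideal_monoid \<longleftrightarrow> is_ideal I \<and> I \<noteq> {0}"
  and mult_ideal_monoid: "I \<otimes>\<^bsub>ideal_monoid\<^esub> J = ideal_prod I J"
  and one_ideal_monoid: "\<one>\<^bsub>ideal_monoid\<^esub> = UNIV"
  unfolding ideal_monoid_def by simp_all

lemmas ideal_monoid_simps = carrier_ideal_monoid mult_ideal_monoid one_ideal_monoid

lemma UNIV_neq_zero: "(UNIV :: 'r::comm_ring_1 set) \<noteq> {0}"
proof
  assume "(UNIV :: 'r set) = {0}"
  hence "(1 :: 'r) \<in> {0}" by (rule subst) (rule UNIV_I)
  thus False by simp
qed

lemma ideal_nonzero_iff: "is_ideal I \<Longrightarrow> I \<noteq> {0} \<longleftrightarrow> (\<exists>x\<in>I. x \<noteq> 0)"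
  using is_ideal_zero by blast

text \<open>The absence of zero divisors keeps products of nonzero ideals nonzero. It is an explicit
  assumption, supplied for polynomials by \<open>mpoly_no_zero_divisors\<close>.\<close>

lemma comm_monoid_ideal_monoid:
  assumes "\<And>a b :: 'r::comm_ring_1. a * b = 0 \<Longrightarrow> a = 0 \<or> b = 0"
  shows "comm_monoid (ideal_monoid :: 'r set monoid)"
proof (rule comm_monoidI)
  fix I J :: "'r set"
  assume I: "I \<in> carrier ideal_monoid" and J: "J \<in> carrier ideal_monoid"
  obtain x y where "x \<in> I" "x \<noteq> 0" "y \<in> J" "y \<noteq> 0"
    using I J ideal_nonzero_iff[of I] ideal_nonzero_iff[of J] unfolding carrier_ideal_monoid by blast
  hence "x * y \<in> ideal_prod I J" "x * y \<noteq> 0" by (auto intro: ideal_prod_memI dest: assms)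
  thus "I \<otimes>\<^bsub>ideal_monoid\<^esub> J \<in> carrier ideal_monoid"
    unfolding ideal_monoid_simps by (auto simp: is_ideal_prod)
next
  show "\<one>\<^bsub>ideal_monoid\<^esub> \<in> carrier (ideal_monoid :: 'r set monoid)"
    unfolding ideal_monoid_simps using is_ideal_UNIV UNIV_neq_zero by blast
next
  show "I \<otimes>\<^bsub>ideal_monoid\<^esub> J = J \<otimes>\<^bsub>ideal_monoid\<^esub> I" for I J :: "'r set"
    unfolding ideal_monoid_simps by (rule ideal_prod_commute)
qed (simp_all add: ideal_monoid_simps ideal_prod_assoc ideal_prod_UNIV)

lemma Units_ideal_monoid:
  "Units (ideal_monoid :: ('r::comm_ring_1) set monoid) = {UNIV}"
proof -
  have "I = UNIV" if I: "I \<in> Units ideal_monoid" for I :: "'r set"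
  proof -
    obtain J where "is_ideal I" "ideal_prod J I = UNIV"
      using I unfolding Units_def ideal_monoid_simps by auto
    thus ?thesis using ideal_prod_subset_right[of I J] by auto
  qed
  moreover have "(UNIV :: 'r set) \<in> carrier ideal_monoid"
    "(UNIV :: 'r set) \<otimes>\<^bsub>ideal_monoid\<^esub> UNIV = \<one>\<^bsub>ideal_monoid\<^esub>"
    using ideal_prod_UNIV[OF is_ideal_UNIV] is_ideal_UNIV UNIV_neq_zero
    by (simp_all add: ideal_monoid_simps)
  hence "(UNIV :: 'r set) \<in> Units ideal_monoid" unfolding Units_def by auto
  ultimately show ?thesis by blast
qed

section \<open>Factorizations in reduced commutative monoids\<close>

lemma (in monoid) mprod_closed: "set us \<subseteq> carrier G \<Longrightarrow> mprod G us \<in> carrier G"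
  by (induction us) (auto simp: mprod_def)

lemma (in monoid) mprod_append:
  "set us \<subseteq> carrier G \<Longrightarrow> set vs \<subseteq> carrier G \<Longrightarrow> mprod G (us @ vs) = mprod G us \<otimes> mprod G vs"
  using mprod_closed by (induction us) (auto simp: mprod_def m_assoc)

lemma (in comm_monoid) mprod_remove1:
  "set us \<subseteq> carrier G \<Longrightarrow> u \<in> set us \<Longrightarrow> mprod G us = u \<otimes> mprod G (remove1 u us)"
proof (induction us)
  case (Cons v us)
  have "mprod G (remove1 u us) \<in> carrier G"
    by (rule mprod_closed) (use Cons.prems set_remove1_subset in force)
  with Cons show ?case by (auto simp: mprod_def m_lcomm)
qed simp

locale reduced_comm_monoid = comm_monoid +
  assumes Units_eq: "Units G = {\<one>}"
begin

lemma atom_closed: "atom G u \<Longrightarrow> u \<in> carrier G"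
  and atom_not_one: "atom G u \<Longrightarrow> u \<noteq> \<one>"
  unfolding atom_def Units_eq by auto

lemma atomD:
  "atom G (a \<otimes> b) \<Longrightarrow> a \<in> carrier G \<Longrightarrow> b \<in> carrier G \<Longrightarrow> a = \<one> \<or> b = \<one>"
  unfolding atom_def Units_eq by blast

lemma atomI:
  "\<lbrakk>u \<in> carrier G; u \<noteq> \<one>; \<And>a b. \<lbrakk>a \<in> carrier G; b \<in> carrier G; u = a \<otimes> b\<rbrakk> \<Longrightarrow> a = \<one> \<or> b = \<one>\<rbrakk>
    \<Longrightarrow> atom G u"
  unfolding atom_def Units_eq by blast

lemma atoms_closed: "set us \<subseteq> {u. atom G u} \<Longrightarrow> set us \<subseteq> carrier G"
  using atom_closed by auto

lemma mult_eq_oneD: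
  assumes "a \<otimes> b = \<one>" "a \<in> carrier G" "b \<in> carrier G"
  shows "a = \<one>"
proof -
  have "a \<in> Units G" using assms m_comm[of a b] unfolding Units_def by auto
  thus ?thesis using Units_eq by simp
qed

lemma lengths_eq: "lengths G a = {length us | us. set us \<subseteq> {u. atom G u} \<and> a = mprod G us}"
  unfolding lengths_def Units_eq using mprod_closed[OF atoms_closed] by fastforce

lemma lengthsI: "set us \<subseteq> {u. atom G u} \<Longrightarrow> length us \<in> lengths G (mprod G us)"
  unfolding lengths_eq by blast

lemma zero_in_lengths_iff: "0 \<in> lengths G a \<longleftrightarrow> a = \<one>"
  unfolding lengths_eq by (auto simp: mprod_def intro: exI[of _ "[]"])

lemma one_in_lengths_iff: "1 \<in> lengths G a \<longleftrightarrow> atom G a"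
proof
  assume "1 \<in> lengths G a"
  then obtain u where "atom G u" "a = mprod G [u]"
    unfolding lengths_eq by (auto simp: length_Suc_conv eq_commute[of "Suc 0"])
  thus "atom G a" using atom_closed by (simp add: mprod_def)
next
  assume "atom G a"
  thus "1 \<in> lengths G a" using lengthsI[of "[a]"] atom_closed by (simp add: mprod_def)
qed

lemma mprod_eq_one: "set us \<subseteq> carrier G \<Longrightarrow> mprod G us = \<one> \<Longrightarrow> set us \<subseteq> {\<one>}"
proof (induction us)
  case (Cons u us)
  hence u: "u = \<one>" using mult_eq_oneD[of u "mprod G us"] mprod_closed[of us] by (auto simp: mprod_def)
  with Cons mprod_closed[of us] show ?case by (auto simp: mprod_def)
qed simp

lemma lengths_one: "lengths G \<one> = {0}"
proof -
  have "length us = 0" if "set us \<subseteq> {u. atom G u}" "\<one> = mprod G us" for us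
    using mprod_eq_one[OF atoms_closed[OF that(1)]] that atom_not_one by (cases us) auto
  moreover have "0 \<in> lengths G \<one>" by (simp add: zero_in_lengths_iff)
  ultimately show ?thesis unfolding lengths_eq by blast
qed

text \<open>Splitting off the first atom leaves a product equal to the identity, which has length
  zero; no cancellation is involved.\<close>

lemma lengths_atom:
  assumes "atom G a"
  shows "lengths G a = {1}"
proof -
  have "length us = 1" if us: "set us \<subseteq> {u. atom G u}" "a = mprod G us" for us
  proof (cases us)
    case Nil
    with us assms atom_not_one show ?thesis by (auto simp: mprod_def)
  next
    case (Cons u vs)
    have vs: "set vs \<subseteq> {u. atom G u}" and u: "atom G u" using us Cons by auto
    have "atom G (u \<otimes> mprod G vs)" using us Cons assms by (simp add: mprod_def)
    hence "mprod G vs = \<one>"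
      using atomD[OF _ atom_closed[OF u] mprod_closed[OF atoms_closed[OF vs]]] u atom_not_one by blast
    hence "length vs \<in> lengths G \<one>" using lengthsI[OF vs] by simp
    thus ?thesis using lengths_one Cons by simp
  qed
  thus ?thesis using assms one_in_lengths_iff[of a] unfolding lengths_eq by blast
qed

text \<open>The listed elements need not be atoms: at each split one side is the identity. This is
  what puts every atom into any generating set.\<close>

lemma atom_mprod_mem:
  "atom G (mprod G us) \<Longrightarrow> set us \<subseteq> carrier G \<Longrightarrow> mprod G us \<in> set us"
proof (induction us)
  case Nil
  thus ?case using atom_not_one by (auto simp: mprod_def)
next
  case (Cons u us)
  have cl: "u \<in> carrier G" "mprod G us \<in> carrier G" using Cons.prems mprod_closed by auto
  have eq: "mprod G (u # us) = u \<otimes> mprod G us" by (simp add: mprod_def)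
  then consider "u = \<one>" | "mprod G us = \<one>" using atomD[OF _ cl] Cons.prems(1) by auto
  thus ?case
  proof cases
    case 1
    thus ?thesis using Cons eq cl by auto
  next
    case 2
    thus ?thesis using eq cl by simp
  qed
qed

text \<open>Otherwise a longest factorization of \<open>a\<close>, followed by one of
  \<open>b\<close>, would be a longer factorization of \<open>a\<close>.\<close>

lemma BF_unit_cancel:
  assumes BF: "BF_monoid G" and a: "a \<in> carrier G" and b: "b \<in> carrier G" and eq: "a = a \<otimes> b"
  shows "b = \<one>"
proof (rule ccontr)
  assume "b \<noteq> \<one>"
  have fin: "finite (lengths G a)" and ne: "lengths G a \<noteq> {}" and neb: "lengths G b \<noteq> {}"
    using BF a b unfolding BF_monoid_def by auto
  obtain us where us: "set us \<subseteq> {u. atom G u}" "a = mprod G us" "length us = Max (lengths G a)"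
    using Max_in[OF fin ne] unfolding lengths_eq[of a] by auto
  obtain vs where vs: "set vs \<subseteq> {u. atom G u}" "b = mprod G vs"
    using neb unfolding lengths_eq[of b] by auto
  have "vs \<noteq> []" using vs \<open>b \<noteq> \<one>\<close> by (auto simp: mprod_def)
  have "a = mprod G (us @ vs)"
    using mprod_append[OF atoms_closed atoms_closed, OF us(1) vs(1)] eq us vs by simp
  hence "length (us @ vs) \<in> lengths G a" using lengthsI[of "us @ vs"] us vs by simp
  hence "length (us @ vs) \<le> Max (lengths G a)" using fin by simp
  thus False using us(3) \<open>vs \<noteq> []\<close> by simp
qed

text \<open>In a cancellative target, $\theta(m)^3 = \theta(m)\theta(A)$ gives
  $\theta(A) = \theta(m)^2$, and lifting this factorization contradicts that $A$ is an atom.\<close>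

lemma not_transfer_cancel:
  fixes B :: "('d, 'y) monoid_scheme"
  assumes m: "atom G m" and A: "atom G A" and eq: "m \<otimes> (m \<otimes> m) = m \<otimes> A"
    and B: "comm_monoid_cancel B" and \<theta>: "transfer_hom G B \<theta>"
  shows False
proof -
  interpret B: comm_monoid_cancel B by (rule B)
  note mc = atom_closed[OF m] and Ac = atom_closed[OF A]
  have hom: "\<theta> (a \<otimes> b) = \<theta> a \<otimes>\<^bsub>B\<^esub> \<theta> b" and cl: "\<theta> a \<in> carrier B"
    if "a \<in> carrier G" "b \<in> carrier G" for a b
    using \<theta> that unfolding transfer_hom_def monoid_hom_def by auto
  have units: "\<theta> u \<in> Units B \<longleftrightarrow> u = \<one>" if "u \<in> carrier G" for u
    using \<theta> that unfolding transfer_hom_def Units_eq by auto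
  have "\<theta> m \<otimes>\<^bsub>B\<^esub> (\<theta> m \<otimes>\<^bsub>B\<^esub> \<theta> m) = \<theta> m \<otimes>\<^bsub>B\<^esub> \<theta> A"
    using eq hom[of m "m \<otimes> m"] hom[of m m] hom[of m A] mc Ac by simp
  hence "\<theta> A = \<theta> m \<otimes>\<^bsub>B\<^esub> \<theta> m" 
    using B.l_cancel[of "\<theta> m" "\<theta> A" "\<theta> m \<otimes>\<^bsub>B\<^esub> \<theta> m"] cl[OF mc mc] cl[OF Ac mc] by simp
  moreover have "\<forall>u\<in>carrier G. \<forall>b\<in>carrier B. \<forall>c\<in>carrier B. \<theta> u = b \<otimes>\<^bsub>B\<^esub> c \<longrightarrow>
      (\<exists>v\<in>carrier G. \<exists>w\<in>carrier G. u = v \<otimes> w \<and>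
        (\<exists>\<epsilon>\<in>Units B. \<theta> v = b \<otimes>\<^bsub>B\<^esub> \<epsilon>) \<and> (\<exists>\<eta>\<in>Units B. \<theta> w = c \<otimes>\<^bsub>B\<^esub> \<eta>))"
    using \<theta> unfolding transfer_hom_def by blast
  ultimately have "\<exists>v\<in>carrier G. \<exists>w\<in>carrier G. A = v \<otimes> w \<and>
        (\<exists>\<epsilon>\<in>Units B. \<theta> v = \<theta> m \<otimes>\<^bsub>B\<^esub> \<epsilon>) \<and> (\<exists>\<eta>\<in>Units B. \<theta> w = \<theta> m \<otimes>\<^bsub>B\<^esub> \<eta>)"
    using Ac cl[OF mc mc] by blast
  then obtain v w \<epsilon> \<eta> where vw: "v \<in> carrier G" "w \<in> carrier G" "A = v \<otimes> w"
    "\<epsilon> \<in> Units B" "\<theta> v = \<theta> m \<otimes>\<^bsub>B\<^esub> \<epsilon>" "\<eta> \<in> Units B" "\<theta> w = \<theta> m \<otimes>\<^bsub>B\<^esub> \<eta>"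
    by blast
  have nu: "\<theta> m \<notin> Units B" using units[OF mc] atom_not_one[OF m] by simp
  have "\<theta> m \<otimes>\<^bsub>B\<^esub> \<epsilon> \<notin> Units B" if "\<epsilon> \<in> Units B" for \<epsilon>
    using nu that B.unit_factor[of "\<theta> m" \<epsilon>] cl[of m] mc by auto
  hence "\<theta> v \<notin> Units B" "\<theta> w \<notin> Units B" using vw by auto
  hence "v \<noteq> \<one>" "w \<noteq> \<one>" using units[OF vw(1)] units[OF vw(2)] by blast+
  thus False using atomD[of v w] A vw by auto
qed

section \<open>Criteria for finiteness properties and for sets of lengths\<close>

lemma not_locally_finitely_generated:
  assumes a: "a \<in> carrier G" and inf: "infinite {u \<in> divisor_closed_gen G a. atom G u}"
  shows "\<not> locally_finitely_generated G"
proof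
  assume "locally_finitely_generated G"
  then obtain E where E: "finite E" "E \<subseteq> divisor_closed_gen G a"
    and gen: "\<And>b. b \<in> divisor_closed_gen G a \<Longrightarrow>
      \<exists>es \<epsilon>. set es \<subseteq> E \<and> \<epsilon> \<in> Units G \<and> b = \<epsilon> \<otimes> mprod G es"
    using a unfolding locally_finitely_generated_def by metis
  have EG: "E \<subseteq> carrier G" using E(2) unfolding divisor_closed_gen_def by auto
  have "u \<in> E" if u: "u \<in> divisor_closed_gen G a" "atom G u" for u
  proof -
    obtain es where es: "set es \<subseteq> E" "u = \<one> \<otimes> mprod G es"
      using gen[OF u(1)] unfolding Units_eq by auto
    have "set es \<subseteq> carrier G" using es EG by auto
    moreover from this have "u = mprod G es" using es mprod_closed by simp
    ultimately show ?thesis using atom_mprod_mem[of es] u es by auto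
  qed
  hence "{u \<in> divisor_closed_gen G a. atom G u} \<subseteq> E" by blast
  thus False using inf E(1) finite_subset by blast
qed

text \<open>In a reduced monoid distinct atoms \<open>u\<close> are not associated, so the
  factorizations of \<open>c\<close> into \<open>m\<close> and \<open>u\<close> are pairwise
  distinct.\<close>

lemma not_FF_monoid:
  assumes m: "atom G m" and inf: "infinite U"
    and U: "\<And>u. u \<in> U \<Longrightarrow> atom G u" and eq: "\<And>u. u \<in> U \<Longrightarrow> m \<otimes> u = c"
  shows "\<not> FF_monoid G"
proof
  assume FF: "FF_monoid G"
  obtain u0 where "u0 \<in> U" using inf by fastforce
  hence c: "c \<in> carrier G" using eq[of u0] U[of u0] atom_closed m by auto
  have cls: "assoc_class G u = {u}" if "atom G u" for u
    using atom_closed[OF that] unfolding assoc_class_def Units_eq by auto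
  have "{#{m}, {u}#} \<in> factorizations G c" if "u \<in> U" for u

  proof -
    have "set [m, u] \<subseteq> {u. atom G u}" "c = \<one> \<otimes> mprod G [m, u]"
      using m U[OF that] eq[OF that] c atom_closed[of u] by (simp_all add: mprod_def)
    moreover have "{#{m}, {u}#} = mset (map (assoc_class G) [m, u])"
      using cls m U[OF that] by simp
    ultimately show ?thesis unfolding factorizations_def Units_eq by blast
  qed
  hence "(\<lambda>u. {#{m}, {u}#}) ` U \<subseteq> factorizations G c" by blast
  moreover have "infinite ((\<lambda>u. {#{m}, {u}#}) ` U)"
    using inf by (subst finite_image_iff) (auto intro!: inj_onI)
  ultimately show False using FF c finite_subset unfolding FF_monoid_def by blast
qed

text \<open>A set of lengths containing \<open>k\<close> excludes 0 and 1, because the identity and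
  the atoms have singleton sets of lengths. Every \<open>l\<close> from 2 on occurs together with
  \<open>k\<close> for \<open>M (max k l)\<close>.\<close>

lemma union_of_sets_of_lengths_eq:
  assumes "\<And>l. l \<ge> 2 \<Longrightarrow> M l \<in> carrier G"
    and "\<And>l. l \<ge> 2 \<Longrightarrow> lengths G (M l) = {2..l}" and k: "k \<ge> 2"
  shows "union_of_sets_of_lengths G k = {2..}"
proof (intro antisym subsetI)
  fix l assume "l \<in> union_of_sets_of_lengths G k"
  then obtain a where a: "k \<in> lengths G a" "l \<in> lengths G a"
    unfolding union_of_sets_of_lengths_def system_of_lengths_def by auto
  have "l \<noteq> 0" using a k zero_in_lengths_iff[of a] lengths_one by fastforce
  moreover have "l \<noteq> 1" using a k one_in_lengths_iff[of a] lengths_atom[of a] by fastforce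
  ultimately show "l \<in> {2..}" by simp
next
  fix l :: nat assume "l \<in> {2..}"
  hence "k \<in> lengths G (M (max k l))" "l \<in> lengths G (M (max k l))"
    "M (max k l) \<in> carrier G"
    using assms(1,2)[of "max k l"] k by auto
  thus "l \<in> union_of_sets_of_lengths G k"
    unfolding union_of_sets_of_lengths_def system_of_lengths_def by blast
qed

lemma fully_elasticI:
  assumes "\<And>r k. k \<ge> 2 \<Longrightarrow> \<exists>a\<in>carrier G. lengths G a = {r + 2..r + k}"
  shows "fully_elastic G"
  unfolding fully_elastic_def
proof safe
  fix q :: rat assume q: "1 < q"
  obtain a b where ab: "quotient_of q = (a, b)" by fastforce
  have b: "b > 0" and qab: "q = of_int a / of_int b"
    using quotient_of_denom_pos[OF ab] quotient_of_div[OF ab] by auto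
  have "a > b" using q b unfolding qab by (simp add: field_simps)
  \<comment> \<open>The interval is to run from \<open>2 * b\<close> to \<open>2 * a\<close>;
    doubling the fraction makes its lower end at least 2.\<close>
  define r where "r = nat (2 * b) - 2"
  define k where "k = nat (2 * (a - b)) + 2"
  have rk: "int (r + 2) = 2 * b" "int (r + k) = 2 * a" "k \<ge> 2"
    unfolding r_def k_def using b \<open>a > b\<close> by auto
  obtain x where x: "x \<in> carrier G" "lengths G x = {r + 2..r + k}" using assms rk by blast
  have "Max {r + 2..r + k} = r + k" "Min {r + 2..r + k} = r + 2"
    using rk by (auto intro: Max_eqI Min_eqI)
  moreover have "{r + 2..r + k} \<noteq> {0}" using rk by auto
  moreover have "real (r + k) = 2 * real_of_int a" "real (r + 2) = 2 * real_of_int b"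
    using rk by linarith+
  ultimately have "elasticity_set (lengths G x) = real_of_rat q"
    unfolding x elasticity_set_def qab by (simp add: of_rat_divide)
  thus "\<exists>L\<in>system_of_lengths G. elasticity_set L = real_of_rat q"
    using x unfolding system_of_lengths_def by blast
qed

text \<open>Every factorization of \<open>p \<otimes> a\<close> contains an atom divisible by
  \<open>p\<close>, hence equal to \<open>p\<close>. Cancelling it leaves a factorization of
  \<open>a\<close>.\<close>

lemma lengths_prime_mult:
  assumes p: "p \<in> carrier G" "p \<noteq> \<one>"
    and prime: "\<And>a b. \<lbrakk>a \<in> carrier G; b \<in> carrier G; p divides a \<otimes> b\<rbrakk> \<Longrightarrow> p divides a \<or> p divides b"
    and cancel: "\<And>a b. \<lbrakk>a \<in> carrier G; b \<in> carrier G; p \<otimes> a = p \<otimes> b\<rbrakk> \<Longrightarrow> a = b"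
    and a: "a \<in> carrier G"
  shows "lengths G (p \<otimes> a) = Suc ` lengths G a"
proof -
  \<comment> \<open>If \<open>p\<close> divides one of its two factors, cancelling \<open>p\<close>
    makes the other factor trivial; with primality this shows that \<open>p\<close> is an
    atom.\<close>
  have half: "y = \<one>" if xy: "x \<in> carrier G" "y \<in> carrier G" "p = x \<otimes> y" and d: "p divides x" for x y
  proof -
    obtain z where z: "z \<in> carrier G" "x = p \<otimes> z" using d unfolding factor_def by blast
    have "p \<otimes> \<one> = p \<otimes> (z \<otimes> y)" 
      by (rule trans[OF trans[OF r_one[OF p(1)] xy(3)[unfolded z(2)]] m_assoc[OF p(1) z(1) xy(2)]])
    hence "z \<otimes> y = \<one>" using cancel[of "\<one>" "z \<otimes> y"] xy(2) z(1) by simp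
    thus "y = \<one>" using mult_eq_oneD[of y z] xy(2) z(1) m_comm[of y z] by simp
  qed
  have patom: "atom G p"
  proof (rule atomI[OF p])
    fix x y assume xy: "x \<in> carrier G" "y \<in> carrier G" "p = x \<otimes> y"
    moreover have "p divides x \<otimes> y" using xy(3) p divides_refl[of p] by simp
    ultimately show "x = \<one> \<or> y = \<one>"
      using half[of x y] half[of y x] prime[of x y] m_comm[of x y] by metis
  qed
  have ex: "\<exists>u\<in>set us. p divides u" if "set us \<subseteq> carrier G" "p divides mprod G us" for us
    using that
  proof (induction us)
    case Nil
    then obtain z where "z \<in> carrier G" "\<one> = p \<otimes> z" unfolding mprod_def factor_def by auto
    thus ?case using mult_eq_oneD[of p z] p by simp
  next
    case (Cons u us)
    thus ?case using prime[of u "mprod G us"] mprod_closed[of us] by (auto simp: mprod_def)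
  qed
  have "n \<in> Suc ` lengths G a" if n: "n \<in> lengths G (p \<otimes> a)" for n
  proof -
    obtain us where us: "set us \<subseteq> {u. atom G u}" "p \<otimes> a = mprod G us" "n = length us"
      using n unfolding lengths_eq by auto
    note ucl = atoms_closed[OF us(1)]
    have "p divides mprod G us" unfolding us(2)[symmetric] factor_def using a by blast
    then obtain u where u: "u \<in> set us" "p divides u" using ex ucl by blast
    obtain z where z: "z \<in> carrier G" "u = p \<otimes> z" using u(2) unfolding factor_def by blast
    have "atom G u" using us u by auto
    hence "z = \<one>" using atomD[of p z] p z by auto
    hence "u = p" using z p by simp
    have sub: "set (remove1 p us) \<subseteq> {u. atom G u}" using us(1) set_remove1_subset by fast
    have "p \<otimes> a = p \<otimes> mprod G (remove1 p us)"
      using us(2) mprod_remove1[OF ucl u(1)] \<open>u = p\<close> by simp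
    hence "a = mprod G (remove1 p us)"
      using cancel a mprod_closed[OF atoms_closed[OF sub]] by blast
    hence "length (remove1 p us) \<in> lengths G a" using lengthsI[OF sub] by simp
    moreover have "n = Suc (length (remove1 p us))"
      using u(1) \<open>u = p\<close> us(3) length_pos_if_in_set[OF u(1)] by (simp add: length_remove1)
    ultimately show ?thesis by blast
  qed
  moreover have "Suc n \<in> lengths G (p \<otimes> a)" if "n \<in> lengths G a" for n
  proof -
    obtain us where us: "set us \<subseteq> {u. atom G u}" "a = mprod G us" "n = length us"
      using \<open>n \<in> lengths G a\<close> unfolding lengths_eq by auto
    thus ?thesis using lengthsI[of "p # us"] patom by (simp add: mprod_def)
  qed
  ultimately show ?thesis by blast
qed

end

section \<open>The bigrading by two of the variables\<close>

abbreviation lookup :: "('k \<Rightarrow>\<^sub>0 'b::zero) \<Rightarrow> 'k \<Rightarrow> 'b" where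
  "lookup \<equiv> Poly_Mapping.lookup"

abbreviation keys :: "('k \<Rightarrow>\<^sub>0 'b::zero) \<Rightarrow> 'k set" where
  "keys \<equiv> Poly_Mapping.keys"

definition rest :: "'n::finite \<Rightarrow> 'n \<Rightarrow> ('n \<Rightarrow>\<^sub>0 nat) \<Rightarrow> nat \<Rightarrow>\<^sub>0 nat" where
  "rest i j e = (\<Sum>k\<in>UNIV - {i, j}. Poly_Mapping.single (to_nat k) (lookup e k))"

text \<open>The substitution $X_i \mapsto s$, $X_j \mapsto st$, where $s$ is the outer and $t$ the inner
  variable. The remaining variables are renumbered by natural numbers because the library
  provides an integral domain of polynomials only for linearly ordered exponents.\<close>

definition bigrading ::
  "'n::finite \<Rightarrow> 'n \<Rightarrow> ('n, 'a::comm_ring_1) mpoly_ring \<Rightarrow> (nat, 'a) mpoly_ring poly poly" where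
  "bigrading i j f = (\<Sum>e\<in>keys f.
     monom (monom (Poly_Mapping.single (rest i j e) (lookup f e)) (lookup e j)) (lookup e i + lookup e j))"

lemma rest_zero: "rest i j 0 = 0"
  by (simp add: rest_def)

lemma rest_add: "rest i j (d + e) = rest i j d + rest i j e"
  by (simp add: rest_def lookup_add single_add sum.distrib)

lemma rest_single: "k \<in> {i, j} \<Longrightarrow> rest i j (Poly_Mapping.single k n) = 0"
  unfolding rest_def by (rule sum.neutral) (auto simp: lookup_single when_def)

lemma lookup_rest:
  assumes "k \<notin> {i, j}"
  shows "lookup (rest i j e) (to_nat k) = lookup e k"
proof -
  have "lookup (rest i j e) (to_nat k) = (\<Sum>l\<in>UNIV - {i, j}. if l = k then lookup e l else 0)"
    unfolding rest_def lookup_sum by (rule sum.cong) (auto simp: lookup_single when_def)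
  thus ?thesis using assms by simp
qed

lemma bigrading_superset:
  "finite A \<Longrightarrow> keys f \<subseteq> A \<Longrightarrow> bigrading i j f = (\<Sum>e\<in>A.
     monom (monom (Poly_Mapping.single (rest i j e) (lookup f e)) (lookup e j)) (lookup e i + lookup e j))"
  unfolding bigrading_def by (rule sum.mono_neutral_left) (auto simp: in_keys_iff)

lemma bigrading_add: "bigrading i j (f + g) = bigrading i j f + bigrading i j g"
proof -
  have *: "finite (keys f \<union> keys g)" by simp
  show ?thesis
    by (simp add: bigrading_superset[OF *] Poly_Mapping.keys_add lookup_add single_add
        add_monom[symmetric] sum.distrib)
qed

lemma bigrading_zero: "bigrading i j 0 = 0"
  by (simp add: bigrading_def)

lemma bigrading_sum: "bigrading i j (sum h A) = (\<Sum>a\<in>A. bigrading i j (h a))"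
  by (induction A rule: infinite_finite_induct) (simp_all add: bigrading_zero bigrading_add)

lemma bigrading_single:
  "bigrading i j (Poly_Mapping.single e c) =
    monom (monom (Poly_Mapping.single (rest i j e) c) (lookup e j)) (lookup e i + lookup e j)"
  by (cases "c = 0") (simp_all add: bigrading_def)

lemma sum_single_lookup:
  fixes f :: "'k \<Rightarrow>\<^sub>0 'b::comm_monoid_add"
  shows "(\<Sum>e\<in>keys f. Poly_Mapping.single e (lookup f e)) = f"
  by (rule poly_mapping_eqI)
    (simp add: lookup_sum lookup_single when_def in_keys_iff)

lemma bigrading_mult: "bigrading i j (f * g) = bigrading i j f * bigrading i j g"
proof -
  have "f * g = (\<Sum>d\<in>keys f. \<Sum>e\<in>keys g. Poly_Mapping.single (d + e) (lookup f d * lookup g e))"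
    by (subst (1 2) sum_single_lookup[symmetric]) (simp add: sum_product mult_single)
  hence "bigrading i j (f * g) = (\<Sum>d\<in>keys f. \<Sum>e\<in>keys g.
      bigrading i j (Poly_Mapping.single (d + e) (lookup f d * lookup g e)))"
    by (simp add: bigrading_sum)
  also have "\<dots> = bigrading i j f * bigrading i j g"
    unfolding bigrading_def[of i j f] bigrading_def[of i j g] sum_product
    by (simp add: bigrading_single mult_monom mult_single rest_add lookup_add ac_simps)
  finally show ?thesis .
qed

lemma bigrading_one: "bigrading i j 1 = 1"
proof -
  have "bigrading i j (Poly_Mapping.single 0 1) = 1"
    unfolding bigrading_single by (simp add: rest_zero monom_0 one_pCons)
  thus ?thesis by simp
qed

lemma bigrading_power: "bigrading i j (f ^ n) = bigrading i j f ^ n"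
  by (induction n) (simp_all add: bigrading_one bigrading_mult)

section \<open>Forms of fixed degree in the two variables\<close>

text \<open>For distinct \<open>i\<close> and \<open>j\<close> this is the homogeneous part of
  degree \<open>d\<close> in the two variables, dehomogenized at \<open>var i\<close>: the
  coefficient of degree \<open>l\<close> belongs to \<open>var i ^ (d - l) * var j ^ l\<close> and
  is a polynomial in the renumbered remaining variables.\<close>

definition form :: "'n::finite \<Rightarrow> 'n \<Rightarrow> nat \<Rightarrow> ('n, 'a::comm_ring_1) mpoly_ring \<Rightarrow> (nat, 'a) mpoly_ring poly"
  where "form i j d f = coeff (bigrading i j f) d"

lemma form_add: "form i j d (f + g) = form i j d f + form i j d g"
  by (simp add: form_def bigrading_add)

lemma form_zero: "form i j d 0 = 0"
  by (simp add: form_def bigrading_zero)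

lemma form_sum: "form i j d (sum h A) = (\<Sum>a\<in>A. form i j d (h a))"
  by (simp add: form_def bigrading_sum coeff_sum)

lemma form_diff: "form i j d (f - g) = form i j d f - form i j d g"
  using form_add[of i j d "f - g" g] by simp

lemma form_single:
  "form i j d (Poly_Mapping.single e c) =
    (if lookup e i + lookup e j = d
     then monom (Poly_Mapping.single (rest i j e) c) (lookup e j) else 0)"
  by (simp add: form_def bigrading_single)

lemma form_mult: "form i j d (f * g) = (\<Sum>k\<le>d. form i j k f * form i j (d - k) g)"
  by (simp add: form_def bigrading_mult coeff_mult)

text \<open>Lowest forms multiply, since in the convolution only the term with degrees
  \<open>p\<close> and \<open>q\<close> can survive.\<close>

lemma form_mult_low:
  assumes "\<And>k. k < p \<Longrightarrow> form i j k f = 0" and "\<And>k. k < q \<Longrightarrow> form i j k g = 0"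
  shows "form i j (p + q) (f * g) = form i j p f * form i j q g"
    and "k < p + q \<Longrightarrow> form i j k (f * g) = 0"
proof -
  have "form i j (p + q) (f * g) =
      (\<Sum>k\<in>{p}. form i j k f * form i j (p + q - k) g)"
    unfolding form_mult
  proof (rule sum.mono_neutral_right)
    show "\<forall>k\<in>{..p + q} - {p}. form i j k f * form i j (p + q - k) g = 0"
    proof
      fix k assume "k \<in> {..p + q} - {p}"
      hence "k < p \<or> p + q - k < q" by auto
      thus "form i j k f * form i j (p + q - k) g = 0" using assms by auto
    qed
  qed auto
  thus "form i j (p + q) (f * g) = form i j p f * form i j q g" by simp
next
  assume "k < p + q"
  hence "l < p \<or> k - l < q" if "l \<le> k" for l using that by auto
  hence "form i j l f * form i j (k - l) g = 0" if "l \<le> k" for l using assms that by fastforce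
  thus "form i j k (f * g) = 0" unfolding form_mult by simp
qed

lemma degree_form: "degree (form i j d f) \<le> d"
proof -
  have "form i j d f = (\<Sum>e\<in>keys f. form i j d (Poly_Mapping.single e (lookup f e)))"
    by (subst sum_single_lookup[symmetric]) (rule form_sum)
  also have "degree \<dots> \<le> d"
    by (rule degree_sum_le) (auto simp: form_single intro: order_trans[OF degree_monom_le])
  finally show ?thesis .
qed

text \<open>A coefficient of a form involves only the remaining variables, so it comes from an
  element of the ring. It can thus act as a scalar inside an ideal.\<close>

lemma form_const_lift: "\<exists>c. form i j 0 c = [:coeff (form i j d f) l:]"
proof -
  define P where "P f \<longleftrightarrow> (\<exists>c. form i j 0 c = [:coeff (form i j d f) l:])"
    for f :: "('a, 'b) mpoly_ring"
  have zero: "P 0" unfolding P_def by (rule exI[of _ 0]) (simp add: form_zero)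
  have add: "P (f + g)" if "P f" "P g" for f g
  proof -
    obtain b c where "form i j 0 b = [:coeff (form i j d f) l:]" "form i j 0 c = [:coeff (form i j d g) l:]"
      using \<open>P f\<close> \<open>P g\<close> unfolding P_def by auto
    hence "form i j 0 (b + c) = [:coeff (form i j d (f + g)) l:]" by (simp add: form_add)
    thus ?thesis unfolding P_def by blast
  qed
  have single: "P (Poly_Mapping.single e c)" for e c
  proof (cases "lookup e i + lookup e j = d \<and> lookup e j = l")
    case True
    \<comment> \<open>Deleting the exponents of \<open>i\<close> and \<open>j\<close> leaves degree
      zero and keeps \<open>rest\<close>.\<close>
    define e' where "e' = e - Poly_Mapping.single i (lookup e i) - Poly_Mapping.single j (lookup e j)"
    have "lookup e' k = (if k \<in> {i, j} then 0 else lookup e k)" for k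
      unfolding e'_def by (auto simp: lookup_minus lookup_single when_def)
    moreover from this have "rest i j e' = rest i j e" unfolding rest_def by (intro sum.cong) auto
    ultimately have "form i j 0 (Poly_Mapping.single e' c) = [:coeff (form i j d (Poly_Mapping.single e c)) l:]"
      using True by (simp add: form_single monom_0)
    thus ?thesis unfolding P_def by blast
  next
    case False
    hence "coeff (form i j d (Poly_Mapping.single e c)) l = 0" by (auto simp: form_single)
    thus ?thesis unfolding P_def by (intro exI[of _ 0]) (simp add: form_zero)
  qed
  have "P (\<Sum>e\<in>A. Poly_Mapping.single e (lookup f e))" for A
    by (induction A rule: infinite_finite_induct) (simp_all add: zero add single)
  hence "P (\<Sum>e\<in>keys f. Poly_Mapping.single e (lookup f e))" .
  thus ?thesis unfolding sum_single_lookup P_def .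
qed

lemma bigrading_var_left: "i \<noteq> j \<Longrightarrow> bigrading i j (var i) = monom 1 1"
  unfolding var_def bigrading_single
  by (simp add: rest_single lookup_single when_def monom_0 one_pCons)

lemma bigrading_var_right: "i \<noteq> j \<Longrightarrow> bigrading i j (var j) = monom (monom 1 1) 1"
  unfolding var_def bigrading_single
  by (simp add: rest_single lookup_single when_def)

lemma bigrading_monomial:
  "i \<noteq> j \<Longrightarrow> bigrading i j (var i ^ a * var j ^ b) = monom (monom 1 b) (a + b)"
  by (simp add: bigrading_mult bigrading_power bigrading_var_left bigrading_var_right monom_power mult_monom)

lemma form_monomial:
  "i \<noteq> j \<Longrightarrow> form i j d (var i ^ a * var j ^ b) = (if d = a + b then monom 1 b else 0)"
  by (simp add: form_def bigrading_monomial)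

lemma exponent_eqI:
  assumes "lookup d i + lookup d j = lookup e i + lookup e j" "lookup d j = lookup e j"
    and "rest i j d = rest i j e"
  shows "d = e"
proof (rule poly_mapping_eqI)
  fix k show "lookup d k = lookup e k"
    using assms lookup_rest[of k i j d] lookup_rest[of k i j e] by (cases "k \<in> {i, j}") auto
qed

text \<open>Degree, exponent of \<open>j\<close> and \<open>rest\<close> together determine the
  exponent vector, so no two monomials collide and the bigrading is injective.\<close>

lemma lookup_form:
  "lookup (coeff (form i j (lookup e i + lookup e j) f) (lookup e j)) (rest i j e) = lookup f e"
proof -
  have "form i j (lookup e i + lookup e j) f =
      (\<Sum>d\<in>keys f. form i j (lookup e i + lookup e j) (Poly_Mapping.single d (lookup f d)))"
    by (subst sum_single_lookup[of f, symmetric]) (rule form_sum)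
  hence "lookup (coeff (form i j (lookup e i + lookup e j) f) (lookup e j)) (rest i j e) =
      (\<Sum>d\<in>keys f. lookup (coeff (form i j (lookup e i + lookup e j)
        (Poly_Mapping.single d (lookup f d))) (lookup e j)) (rest i j e))"
    by (simp add: coeff_sum lookup_sum)
  also have "\<dots> = (\<Sum>d\<in>keys f. if d = e then lookup f d else 0)"
  proof (rule sum.cong[OF refl])
    fix d
    show "lookup (coeff (form i j (lookup e i + lookup e j) (Poly_Mapping.single d (lookup f d)))
        (lookup e j)) (rest i j e) = (if d = e then lookup f d else 0)"
      using exponent_eqI[of d i j e] by (auto simp: form_single lookup_single when_def)
  qed
  finally show ?thesis by (simp add: in_keys_iff)
qed

lemma form_eq_0D: "(\<And>d. form i j d f = 0) \<Longrightarrow> f = 0"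
  by (rule poly_mapping_eqI) (simp flip: lookup_form[of i j _ f])

text \<open>The bigrading is an injective multiplicative map into an iterated polynomial ring that
  is a domain; any \<open>i\<close> and \<open>j\<close> serve.\<close>

lemma mpoly_no_zero_divisors:
  fixes f g :: "('n::finite, 'a::idom) mpoly_ring"
  assumes "f * g = 0"
  shows "f = 0 \<or> g = 0"
proof -
  fix i j :: 'n
  have "bigrading i j f * bigrading i j g = 0"
    using assms by (simp add: bigrading_zero flip: bigrading_mult)
  hence "bigrading i j f = 0 \<or> bigrading i j g = 0" by simp
  thus ?thesis using form_eq_0D[of i j f] form_eq_0D[of i j g] by (auto simp: form_def)
qed

section \<open>The powers of the ideal generated by two variables\<close>

text \<open>For distinct \<open>i\<close> and \<open>j\<close> this is the \<open>k\<close>-th power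
  of the ideal generated by the two variables, encoded by the vanishing of low forms so that orders
  can be compared.\<close>

definition order_ideal :: "'n::finite \<Rightarrow> 'n \<Rightarrow> nat \<Rightarrow> ('n, 'a::comm_ring_1) mpoly_ring set" where
  "order_ideal i j k = {f. \<forall>d<k. form i j d f = 0}"

lemma order_idealD: "f \<in> order_ideal i j k \<Longrightarrow> d < k \<Longrightarrow> form i j d f = 0"
  unfolding order_ideal_def by blast

lemma order_ideal_mult:
  assumes "f \<in> order_ideal i j p" "g \<in> order_ideal i j q"
  shows "f * g \<in> order_ideal i j (p + q)"
    and "form i j (p + q) (f * g) = form i j p f * form i j q g"
  using form_mult_low[of p i j f q g] assms unfolding order_ideal_def by auto

lemma order_ideal_0: "order_ideal i j 0 = UNIV"
  by (simp add: order_ideal_def)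

lemma is_ideal_order_ideal: "is_ideal (order_ideal i j k)"
  unfolding is_ideal_def
proof (intro conjI ballI allI)
  show "r * f \<in> order_ideal i j k" if "f \<in> order_ideal i j k" for r f
    using order_ideal_mult(1)[of r i j 0 f k] that by (simp add: order_ideal_0)
qed (auto simp: order_ideal_def form_zero form_add)

lemma form_mult_const:
  "f \<in> order_ideal i j d \<Longrightarrow> form i j d (r * f) = form i j 0 r * form i j d f"
  using order_ideal_mult(2)[of r i j 0 f d] by (simp add: order_ideal_0)

lemma monomial_mem_order_ideal:
  "i \<noteq> j \<Longrightarrow> k \<le> a + b \<Longrightarrow> var i ^ a * var j ^ b \<in> order_ideal i j k"
  by (auto simp: order_ideal_def form_monomial)

lemma monomial_mem_order_ideal_iff:
  "i \<noteq> j \<Longrightarrow> var i ^ a * var j ^ b \<in> (order_ideal i j k :: ('n::finite, 'a::idom) mpoly_ring set)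
    \<longleftrightarrow> k \<le> a + b"
  using monomial_mem_order_ideal[of i j k a b]
  by (auto simp: order_ideal_def form_monomial not_less[symmetric])

lemma var_power: "var i ^ n = Poly_Mapping.single (Poly_Mapping.single i n) 1"
  by (induction n) (simp_all add: var_def mult_single single_add[symmetric])

lemma single_divisible:
  assumes "i \<noteq> j" "a \<le> lookup e i" "b \<le> lookup e j"
  shows "\<exists>g. Poly_Mapping.single e c = g * (var i ^ a * var j ^ b)"
proof -
  define d where "d = e - Poly_Mapping.single i a - Poly_Mapping.single j b"
  have "e = d + (Poly_Mapping.single i a + Poly_Mapping.single j b)"
    by (rule poly_mapping_eqI)
      (use assms in \<open>auto simp: d_def lookup_add lookup_minus lookup_single when_def\<close>)
  hence "Poly_Mapping.single e c = Poly_Mapping.single d c * (var i ^ a * var j ^ b)"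
    by (simp add: var_power mult_single)
  thus ?thesis by blast
qed

lemma mem_order_ideal_keys:
  assumes "f \<in> order_ideal i j k" "e \<in> keys f"
  shows "k \<le> lookup e i + lookup e j"
proof (rule ccontr)
  assume "\<not> ?thesis"
  hence "form i j (lookup e i + lookup e j) f = 0" using assms(1) by (auto simp: order_ideal_def)
  hence "lookup f e = 0" using lookup_form[of i j e f] by simp
  thus False using assms(2) by (simp add: in_keys_iff)
qed

lemma order_ideal_least:
  assumes ij: "i \<noteq> j" and K: "is_ideal K"
    and mon: "\<And>l. l \<le> k \<Longrightarrow> var i ^ (k - l) * var j ^ l \<in> K"
  shows "order_ideal i j k \<subseteq> K"
proof
  fix f :: "('a, 'b) mpoly_ring" assume f: "f \<in> order_ideal i j k"
  have "Poly_Mapping.single e (lookup f e) \<in> K" if e: "e \<in> keys f" for e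
  proof -
    \<comment> \<open>With as many factors \<open>var j\<close> as available, up to
      \<open>k\<close>, at most \<open>lookup e i\<close> factors \<open>var i\<close>
      remain.\<close>
    define l where "l = min k (lookup e j)"
    have "k - l \<le> lookup e i" "l \<le> lookup e j" "l \<le> k"
      using mem_order_ideal_keys[OF f e] by (auto simp: l_def)
    then obtain g where "Poly_Mapping.single e (lookup f e) = g * (var i ^ (k - l) * var j ^ l)"
      using single_divisible[OF ij] by blast
    thus ?thesis using is_ideal_mult[OF K mon] \<open>l \<le> k\<close> by simp
  qed
  hence "(\<Sum>e\<in>keys f. Poly_Mapping.single e (lookup f e)) \<in> K" by (rule is_ideal_sum[OF K])
  thus "f \<in> K" unfolding sum_single_lookup .
qed

text \<open>A monomial of degree \<open>k + l\<close> splits into monomials of degrees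
  \<open>k\<close> and \<open>l\<close>; \<open>b\<close> is the largest share of \<open>y\<close>
  that the first can take.\<close>

lemma power_mult_power_split:
  fixes x y :: "'r::comm_semiring_1"
  assumes "n \<le> k + l"
  defines "b \<equiv> min k n"
  shows "x ^ (k + l - n) * y ^ n = (x ^ (k - b) * y ^ b) * (x ^ (l - (n - b)) * y ^ (n - b))"
proof -
  have "x ^ (k + l - n) = x ^ (k - b) * x ^ (l - (n - b))" "y ^ n = y ^ b * y ^ (n - b)"
    using assms by (auto simp: b_def min_def simp flip: power_add)
  thus ?thesis by (simp add: ac_simps)
qed

lemma order_ideal_prod:
  assumes ij: "i \<noteq> j"
  shows "ideal_prod (order_ideal i j k) (order_ideal i j l) = order_ideal i j (k + l)"
proof (rule antisym)
  show "ideal_prod (order_ideal i j k) (order_ideal i j l) \<subseteq> order_ideal i j (k + l)"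
    by (rule ideal_prod_least[OF is_ideal_order_ideal order_ideal_mult(1)])
  show "order_ideal i j (k + l) \<subseteq> ideal_prod (order_ideal i j k) (order_ideal i j l)"
  proof (rule order_ideal_least[OF ij is_ideal_prod])
    fix n assume n: "n \<le> k + l"
    define b where "b = min k n"
    show "var i ^ (k + l - n) * var j ^ n \<in> ideal_prod (order_ideal i j k) (order_ideal i j l)"
      unfolding power_mult_power_split[OF n, folded b_def]
      using n by (intro ideal_prod_memI monomial_mem_order_ideal ij) (auto simp: b_def)
  qed
qed

lemma gen_ideal_vars:
  assumes ij: "i \<noteq> j"
  shows "gen_ideal {var i, var j} = order_ideal i j 1"
proof (rule antisym)
  have "var i \<in> order_ideal i j 1" "var j \<in> order_ideal i j 1"
    using monomial_mem_order_ideal[OF ij, of 1 1 0] monomial_mem_order_ideal[OF ij, of 1 0 1] by simp_all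
  thus "gen_ideal {var i, var j} \<subseteq> order_ideal i j 1"
    by (intro gen_ideal_least is_ideal_order_ideal) simp
  show "order_ideal i j 1 \<subseteq> gen_ideal {var i, var j}"
  proof (rule order_ideal_least[OF ij is_ideal_gen_ideal])
    fix l :: nat assume "l \<le> 1"
    thus "var i ^ (1 - l) * var j ^ l \<in> gen_ideal {var i, var j}"
      using gen_ideal_superset[of "{var i, var j}"] by (cases l) auto
  qed
qed

section \<open>A criterion for atoms by lowest forms\<close>

lemma coeff_order_0:
  assumes "F \<noteq> (0 :: 'a::idom poly)"
  shows "coeff F (Polynomial.order 0 F) \<noteq> 0"
    and "k < Polynomial.order 0 F \<Longrightarrow> coeff F k = 0"
proof -
  show low: "coeff F k = 0" if "k < Polynomial.order 0 F" for k
    using that monom_1_dvd_iff[OF assms, of "Polynomial.order 0 F"]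
      monom_1_dvd_iff'[of "Polynomial.order 0 F" F] by simp
  show "coeff F (Polynomial.order 0 F) \<noteq> 0"
  proof
    assume "coeff F (Polynomial.order 0 F) = 0"
    hence "\<forall>k < Suc (Polynomial.order 0 F). coeff F k = 0" using low by (auto simp: less_Suc_eq)
    thus False
      using monom_1_dvd_iff[OF assms, of "Suc (Polynomial.order 0 F)"]
        monom_1_dvd_iff'[of "Suc (Polynomial.order 0 F)" F] by simp
  qed
qed

lemma order_0_eq_0_iff:
  "F \<noteq> (0 :: 'a::idom poly) \<Longrightarrow> Polynomial.order 0 F = 0 \<longleftrightarrow> coeff F 0 \<noteq> 0"
  using coeff_order_0[of F] by (metis neq0_conv)

lemma form_mult_smult:
  assumes "f \<in> order_ideal i j d"
  shows "form i j d (r * f) = smult (coeff (form i j 0 r) 0) (form i j d f)"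
proof -
  have "form i j 0 r = [:coeff (form i j 0 r) 0:]"
    using degree_form[of i j 0 r] by (metis degree_0_id le_zero_eq)
  hence "form i j d (r * f) = [:coeff (form i j 0 r) 0:] * form i j d f"
    using form_mult_const[OF assms, of r] by metis
  thus ?thesis by simp
qed

text \<open>On elements of order at least \<open>d\<close>, multiplication by a ring element scales
  the form of degree \<open>d\<close>. Hence linear conditions on these forms cut out ideals, and
  can be checked on generators.\<close>

lemma is_ideal_forms_in:
  assumes "0 \<in> W" "\<And>F G. F \<in> W \<Longrightarrow> G \<in> W \<Longrightarrow> F + G \<in> W" "\<And>c F. F \<in> W \<Longrightarrow> smult c F \<in> W"
  shows "is_ideal {f \<in> order_ideal i j d. form i j d f \<in> W}"
  unfolding is_ideal_def
  using is_ideal_order_ideal[of i j d] assms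
  by (auto simp: form_zero form_add form_mult_smult intro: is_ideal_zero is_ideal_add is_ideal_mult)

lemma reduced_comm_monoid_mpoly:
  "reduced_comm_monoid (ideal_monoid :: ('n::finite, 'a::idom) mpoly_ring set monoid)"
  by (intro reduced_comm_monoid.intro comm_monoid_ideal_monoid reduced_comm_monoid_axioms.intro
      mpoly_no_zero_divisors) (simp_all add: Units_ideal_monoid one_ideal_monoid)

locale two_variables =
  fixes i j :: "'n::finite" and T :: "'a::idom itself"
  assumes ij: "i \<noteq> j"
    and BF: "BF_monoid (ideal_monoid :: ('n, 'a) mpoly_ring set monoid)"
begin

abbreviation G :: "('n, 'a) mpoly_ring set monoid" where "G \<equiv> ideal_monoid"
abbreviation X :: "('n, 'a) mpoly_ring" where "X \<equiv> var i"
abbreviation Y :: "('n, 'a) mpoly_ring" where "Y \<equiv> var j"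
abbreviation M :: "nat \<Rightarrow> ('n, 'a) mpoly_ring set" where "M \<equiv> order_ideal i j"
abbreviation frm :: "nat \<Rightarrow> ('n, 'a) mpoly_ring \<Rightarrow> (nat, 'a) mpoly_ring poly" where
  "frm \<equiv> form i j"

sublocale reduced_comm_monoid G
  by (rule reduced_comm_monoid_mpoly)

lemma monomial_in_M_iff: "X ^ a * Y ^ b \<in> M k \<longleftrightarrow> k \<le> a + b"
  by (rule monomial_mem_order_ideal_iff[OF ij])

lemma frm_monomial: "frm d (X ^ a * Y ^ b) = (if d = a + b then monom 1 b else 0)"
  by (rule form_monomial[OF ij])

lemma M_least: "is_ideal K \<Longrightarrow> (\<And>l. l \<le> k \<Longrightarrow> X ^ (k - l) * Y ^ l \<in> K) \<Longrightarrow> M k \<subseteq> K"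
  by (rule order_ideal_least[OF ij])

lemma M_prod: "ideal_prod (M k) (M l) = M (k + l)"
  by (rule order_ideal_prod[OF ij])

lemma carrierI: "is_ideal I \<Longrightarrow> f \<in> I \<Longrightarrow> f \<noteq> 0 \<Longrightarrow> I \<in> carrier G"
  unfolding carrier_ideal_monoid by blast

lemma carrier_is_ideal: "I \<in> carrier G \<Longrightarrow> is_ideal I"
  unfolding carrier_ideal_monoid by blast

lemma monomial_neq_0: "X ^ a * Y ^ b \<noteq> 0"
proof
  assume "X ^ a * Y ^ b = 0"
  hence "frm (a + b) (X ^ a * Y ^ b) = 0" by (simp add: form_zero)
  thus False by (simp add: frm_monomial)
qed

lemma M_closed: "M k \<in> carrier G"
  by (rule carrierI[OF is_ideal_order_ideal _ monomial_neq_0[of k 0]]) (unfold monomial_in_M_iff, simp)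

lemma M_eq_UNIV_iff: "M k = UNIV \<longleftrightarrow> k = 0"
  using monomial_in_M_iff[of 0 0 k] by (auto simp: order_ideal_0)

lemma unit_cancel:
  assumes "I \<in> carrier G" "J \<in> carrier G" "ideal_prod I J = I"
  shows "J = UNIV"
  using BF_unit_cancel[OF BF assms(1,2)] assms(3) by (simp add: ideal_monoid_simps)

text \<open>Multiplication by an element with nonzero form of degree zero preserves orders. So
  \<open>J\<close> lies in \<open>M k\<close>, hence equals it, and unit-cancellation makes
  \<open>I\<close> trivial.\<close>

lemma factor_M_eq_UNIV:
  assumes I: "I \<in> carrier G" and J: "J \<in> carrier G" and eq: "ideal_prod I J = M k"
    and nsub: "\<not> I \<subseteq> M 1"
  shows "I = UNIV"
proof -
  obtain f where f: "f \<in> I" "frm 0 f \<noteq> 0" using nsub by (auto simp: order_ideal_def)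
  have "J \<subseteq> M k"
  proof
    fix g assume g: "g \<in> J"
    show "g \<in> M k"
    proof (rule ccontr)
      assume "g \<notin> M k"
      hence "\<exists>d. d < k \<and> frm d g \<noteq> 0" by (auto simp: order_ideal_def)
      then obtain d where d: "d < k" "frm d g \<noteq> 0" and min: "\<forall>m<d. \<not> (m < k \<and> frm m g \<noteq> 0)"
        unfolding exists_least_iff[of "\<lambda>d. d < k \<and> frm d g \<noteq> 0"] by auto
      have "g \<in> M d" using min d(1) unfolding order_ideal_def by auto
      hence "frm (0 + d) (f * g) = frm 0 f * frm d g"
        by (intro order_ideal_mult(2)) (simp_all add: order_ideal_0)
      moreover have "f * g \<in> M k" using ideal_prod_memI[OF f(1) g] eq by simp
      ultimately show False using d f order_idealD[of "f * g" i j k d] by simp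
    qed
  qed
  moreover have "M k \<subseteq> J" using ideal_prod_subset_right[OF carrier_is_ideal[OF J], of I] eq by simp
  ultimately have "J = M k" by simp
  hence "ideal_prod J I = J" using eq ideal_prod_commute[of J I] by simp
  thus "I = UNIV" by (rule unit_cancel[OF J I])
qed

text \<open>Here \<open>p\<close> is the order of \<open>I\<close>, the least degree in which some
  element has a nonzero form.\<close>

lemma order_exists:
  assumes "I \<in> carrier G"
  obtains p f where "I \<subseteq> M p" "f \<in> I" "frm p f \<noteq> 0"
proof -
  obtain f where "f \<in> I" "f \<noteq> 0"
    using assms ideal_nonzero_iff[of I] unfolding carrier_ideal_monoid by blast
  hence "\<exists>p. \<exists>f\<in>I. frm p f \<noteq> 0" using form_eq_0D[of i j f] by auto
  then obtain p where p: "\<exists>f\<in>I. frm p f \<noteq> 0" and min: "\<forall>m<p. \<not> (\<exists>f\<in>I. frm m f \<noteq> 0)"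
    unfolding exists_least_iff[of "\<lambda>p. \<exists>f\<in>I. frm p f \<noteq> 0"] by auto
  have "I \<subseteq> M p" using min unfolding order_ideal_def by auto
  thus ?thesis using p that by auto
qed

text \<open>Otherwise all products \<open>f * g\<close> would have forms with constant coefficient
  zero, a condition that passes to the ideal they generate.\<close>

lemma ex_factor_low_coeff:
  assumes I: "I \<subseteq> M p" and J: "J \<subseteq> M q"
    and v: "v \<in> ideal_prod I J" "coeff (frm (p + q) v) 0 \<noteq> 0"
  shows "\<exists>f\<in>I. coeff (frm p f) 0 \<noteq> 0"
proof (rule ccontr)
  assume *: "\<not> ?thesis"
  let ?K = "{f \<in> M (p + q). frm (p + q) f \<in> {F. coeff F 0 = 0}}"
  have "ideal_prod I J \<subseteq> ?K"
  proof (rule ideal_prod_least)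
    show "is_ideal ?K" by (rule is_ideal_forms_in) auto
    fix f g assume fg: "f \<in> I" "g \<in> J"
    hence "f \<in> M p" "g \<in> M q" using I J by auto
    thus "f * g \<in> ?K" using order_ideal_mult[of f i j p g q] * fg by (simp add: coeff_mult_0)
  qed
  thus False using v by auto
qed

text \<open>If no element of \<^term>\<open>I\<close> of minimal order had a form divisible by the inner variable, then
  all these forms would be proportional to a single form, which would divide the forms of the
  product up to a constant; but the forms of the product have no common factor.\<close>

lemma ex_factor_high_order:
  assumes idl: "is_ideal I" and I: "I \<subseteq> M p" and J: "J \<subseteq> M q" and p: "p \<noteq> 0"
    and low: "u \<in> ideal_prod I J" "coeff (frm (p + q) u) 0 \<noteq> 0"
    and high: "v \<in> ideal_prod I J" "coeff (frm (p + q) v) (p + q) \<noteq> 0"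
    and mon: "w \<in> ideal_prod I J" "frm (p + q) w = monom c l" "c \<noteq> 0"
  shows "\<exists>f\<in>I. frm p f \<noteq> 0 \<and> coeff (frm p f) 0 = 0"
proof (rule ccontr)
  assume neg: "\<not> ?thesis"
  obtain f0 where f0: "f0 \<in> I" "coeff (frm p f0) 0 \<noteq> 0" using ex_factor_low_coeff[OF I J low] by blast
  define F0 where "F0 = frm p f0"
  define c0 where "c0 = coeff F0 0"
  have c0: "c0 \<noteq> 0" using f0 by (simp add: c0_def F0_def)
  have F0: "F0 \<noteq> 0" using c0 by (auto simp: c0_def)
  have proportional: "smult c0 (frm p f) = smult (coeff (frm p f) 0) F0" if f: "f \<in> I" for f
  proof -
    \<comment> \<open>Elements \<open>a\<close> and \<open>b\<close> lift the two constant
      coefficients, so that the constant coefficient of the form of \<open>a * f - b * f0\<close>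
      cancels; by \<open>neg\<close> that form vanishes.\<close>
    obtain a where a: "frm 0 a = [:c0:]"
      using form_const_lift[of i j p f0 0] unfolding c0_def F0_def by auto
    obtain b where b: "frm 0 b = [:coeff (frm p f) 0:]" using form_const_lift[of i j p f 0] by auto
    have "a * f - b * f0 \<in> I" using is_ideal_diff is_ideal_mult idl f f0 by metis
    moreover have eq: "frm p (a * f - b * f0) = smult c0 (frm p f) - smult (coeff (frm p f) 0) F0"
      using form_mult_const[OF subsetD[OF I f], of a] form_mult_const[OF subsetD[OF I f0(1)], of b] a b
      by (simp add: form_diff F0_def)
    moreover have "coeff (frm p (a * f - b * f0)) 0 = 0" unfolding eq by (simp add: c0_def)
    ultimately have "frm p (a * f - b * f0) = 0" using neg by blast
    thus ?thesis using eq by simp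
  qed
  \<comment> \<open>Keeping the factor \<open>c0\<close> avoids division by it; the degree bound on
    \<open>H\<close> pins down the degree of \<open>F0\<close> below.\<close>
  let ?W = "{F. \<exists>H. degree H \<le> q \<and> smult c0 F = F0 * H}"
  let ?K = "{f \<in> M (p + q). frm (p + q) f \<in> ?W}"
  have "ideal_prod I J \<subseteq> ?K"
  proof (rule ideal_prod_least)
    show "is_ideal ?K"
    proof (rule is_ideal_forms_in)
      show "0 \<in> ?W" by (auto intro: exI[of _ 0])
    next
      fix F F' assume "F \<in> ?W" "F' \<in> ?W"
      then obtain H H' where "degree H \<le> q" "smult c0 F = F0 * H" "degree H' \<le> q" "smult c0 F' = F0 * H'"
        by blast
      hence "degree (H + H') \<le> q" "smult c0 (F + F') = F0 * (H + H')"
        by (auto simp: smult_add_right distrib_left intro: degree_add_le)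
      thus "F + F' \<in> ?W" by blast
    next
      fix b F assume "F \<in> ?W"
      then obtain H where H: "degree H \<le> q" "smult c0 F = F0 * H" by blast
      have "smult c0 (smult b F) = smult b (smult c0 F)" by (simp add: mult.commute)
      hence "degree (smult b H) \<le> q" "smult c0 (smult b F) = F0 * smult b H"
        using order_trans[OF degree_smult_le H(1)] H(2) by simp_all
      thus "smult b F \<in> ?W" by blast
    qed
    fix f g assume fg: "f \<in> I" "g \<in> J"
    hence fgM: "f \<in> M p" "g \<in> M q" using I J by auto
    have "smult c0 (frm (p + q) (f * g)) = smult c0 (frm p f) * frm q g"
      using order_ideal_mult(2)[OF fgM] by simp
    also have "\<dots> = F0 * smult (coeff (frm p f) 0) (frm q g)" using proportional[OF fg(1)] by simp
    finally have "frm (p + q) (f * g) \<in> ?W"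
      using order_trans[OF degree_smult_le degree_form] by blast
    thus "f * g \<in> ?K" using order_ideal_mult(1)[OF fgM] by simp
  qed
  hence div: "\<exists>H. degree H \<le> q \<and> smult c0 (frm (p + q) f) = F0 * H" if "f \<in> ideal_prod I J" for f
    using that by auto
  have degF0: "degree F0 = p"
  proof (rule antisym)
    show "degree F0 \<le> p" unfolding F0_def by (rule degree_form)
    obtain H where H: "degree H \<le> q" "smult c0 (frm (p + q) v) = F0 * H" using div[OF high(1)] by blast
    have "coeff (F0 * H) (p + q) \<noteq> 0" using high(2) c0 H(2)[symmetric] by simp
    hence "p + q \<le> degree (F0 * H)" by (rule le_degree)
    also have "\<dots> \<le> degree F0 + degree H" by (rule degree_mult_le)
    finally show "p \<le> degree F0" using H(1) by simp
  qed
  obtain H where H: "monom (c0 * c) l = F0 * H" using div[OF mon(1)] mon(2) by (auto simp: smult_monom)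
  have ne: "F0 * H \<noteq> 0" using H c0 mon(3) by (metis monom_eq_0_iff no_zero_divisors)
  \<comment> \<open>\<open>F0\<close> has order zero, so \<open>H\<close> carries the whole order
    \<open>l\<close> of the monomial; the degree \<open>l\<close> then leaves nothing for
    \<open>F0\<close>.\<close>
  have "l = Polynomial.order 0 (F0 * H)"
    using H order_0_monom[of "c0 * c" l] c0 mon(3) by simp
  also have "\<dots> = Polynomial.order 0 H"
    using order_mult[OF ne, of 0] order_0_eq_0_iff[OF F0] c0 by (simp add: c0_def)
  also have "\<dots> \<le> degree H" using ne by (intro order_degree) auto
  finally have "l \<le> degree H" .
  moreover have "l = degree F0 + degree H"
    using H ne degree_monom_eq[of "c0 * c" l] degree_mult_eq[of F0 H] c0 mon(3) by simp
  ultimately show False using degF0 p by simp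
qed

text \<open>In a factorization into factors of positive order, the factors contain forms with odd orders
  and forms with order zero; the product of two forms with odd orders has positive even order.\<close>

lemma atom_by_forms:
  assumes A: "is_ideal A" and AM: "A \<subseteq> M d" and d: "d \<noteq> 0"
    and prod: "ideal_prod A (M t) = M (d + t)"
    and parity: "\<And>f. f \<in> A \<Longrightarrow> frm d f \<noteq> 0 \<Longrightarrow>
      Polynomial.order 0 (frm d f) = 0 \<or> odd (Polynomial.order 0 (frm d f))"
    and low: "u \<in> A" "coeff (frm d u) 0 \<noteq> 0"
    and high: "v \<in> A" "coeff (frm d v) d \<noteq> 0"
    and mon: "w \<in> A" "frm d w = monom c l" "c \<noteq> 0"
  shows "atom G A"
proof (rule atomI)
  have u0: "u \<noteq> 0" using low by (auto simp: form_zero)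
  show "A \<in> carrier G" by (rule carrierI[OF A low(1) u0])
  show "A \<noteq> \<one>\<^bsub>G\<^esub>"
    using AM d M_eq_UNIV_iff[of d] by (auto simp: one_ideal_monoid)
  fix I J assume I: "I \<in> carrier G" and J: "J \<in> carrier G" and "A = I \<otimes>\<^bsub>G\<^esub> J"
  hence eq: "A = ideal_prod I J" and eq': "A = ideal_prod J I"
    by (simp_all add: mult_ideal_monoid ideal_prod_commute)
  obtain p f1 where f1: "I \<subseteq> M p" "f1 \<in> I" "frm p f1 \<noteq> 0" by (rule order_exists[OF I])
  obtain q g1 where g1: "J \<subseteq> M q" "g1 \<in> J" "frm q g1 \<noteq> 0" by (rule order_exists[OF J])
  have prodM: "f * g \<in> A" "frm (p + q) (f * g) = frm p f * frm q g" "f * g \<in> M (p + q)"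
    if "f \<in> I" "g \<in> J" for f g
    using ideal_prod_memI[OF that] order_ideal_mult[of f i j p g q] f1(1) g1(1) that eq by auto
  \<comment> \<open>Orders add: comparing with \<open>u\<close> and with \<open>f1 * g1\<close>
    gives \<open>d = p + q\<close>.\<close>
  have "A \<subseteq> M (p + q)" unfolding eq
    by (rule ideal_prod_least[OF is_ideal_order_ideal prodM(3)])
  hence "\<not> d < p + q" using low order_idealD[of u i j "p + q" d] by auto
  moreover have "\<not> p + q < d"
    using prodM[OF f1(2) g1(2)] f1(3) g1(3) AM order_idealD[of "f1 * g1" i j d "p + q"] by auto
  ultimately have pq: "d = p + q" by simp
  \<comment> \<open>Multiplication by \<open>M t\<close> turns a factorization of \<open>A\<close>
    into one of \<open>M (d + t)\<close>, to which \<open>factor_M_eq_UNIV\<close> applies.\<close>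
  have unit: "I = UNIV" if "\<not> I \<subseteq> M 1" "I \<in> carrier G" "J \<in> carrier G" "A = ideal_prod I J" for I J
  proof (rule factor_M_eq_UNIV[OF that(2) _ _ that(1)])
    show "ideal_prod J (M t) \<in> carrier G"
      using m_closed[OF that(3) M_closed[of t]] by (simp add: mult_ideal_monoid)
    show "ideal_prod I (ideal_prod J (M t)) = M (d + t)"
      using prod that(4) by (simp add: ideal_prod_assoc)
  qed
  show "I = \<one>\<^bsub>G\<^esub> \<or> J = \<one>\<^bsub>G\<^esub>"
  proof (cases "p = 0 \<or> q = 0")
    case True
    hence "\<not> I \<subseteq> M 1 \<or> \<not> J \<subseteq> M 1"
      using f1 g1 order_idealD[of f1 i j 1 0] order_idealD[of g1 i j 1 0] by auto
    thus ?thesis using unit[OF _ I J eq] unit[OF _ J I eq'] by (auto simp: one_ideal_monoid)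
  next
    case False
    note low' = low[unfolded pq] and high' = high[unfolded pq] and mon' = mon[unfolded pq]
    obtain f where f: "f \<in> I" "frm p f \<noteq> 0" "coeff (frm p f) 0 = 0"
      using ex_factor_high_order[OF carrier_is_ideal[OF I] f1(1) g1(1) _ low'[unfolded eq]
          high'[unfolded eq] mon'[unfolded eq]] False by auto
    obtain g where g: "g \<in> J" "frm q g \<noteq> 0" "coeff (frm q g) 0 = 0"
      using ex_factor_high_order[OF carrier_is_ideal[OF J] g1(1) f1(1) _
          low'[unfolded eq' add.commute[of p]] high'[unfolded eq' add.commute[of p]]
          mon'[unfolded eq' add.commute[of p]]] False by auto
    obtain f0 where f0: "f0 \<in> I" "coeff (frm p f0) 0 \<noteq> 0"
      using ex_factor_low_coeff[OF f1(1) g1(1) low'[unfolded eq]] by blast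
    obtain g0 where g0: "g0 \<in> J" "coeff (frm q g0) 0 \<noteq> 0"
      using ex_factor_low_coeff[OF g1(1) f1(1) low'[unfolded eq' add.commute[of p]]] by blast
    have par: "Polynomial.order 0 (frm p f') + Polynomial.order 0 (frm q g') = 0 \<or>
        odd (Polynomial.order 0 (frm p f') + Polynomial.order 0 (frm q g'))"
      if "f' \<in> I" "g' \<in> J" "frm p f' \<noteq> 0" "frm q g' \<noteq> 0" for f' g'
    proof -
      have ne: "frm p f' * frm q g' \<noteq> 0" using that by simp
      show ?thesis
        using parity[of "f' * g'"] prodM[OF that(1,2)] ne order_mult[OF ne, of 0] pq by simp
    qed
    have "frm p f0 \<noteq> 0" "frm q g0 \<noteq> 0" using f0 g0 by auto
    \<comment> \<open>Paired with \<open>g0\<close> and \<open>f0\<close>, the positive orders of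
      the forms of \<open>f\<close> and \<open>g\<close> must be odd; then their sum is positive and
      even, against \<open>par\<close>.\<close>
    thus ?thesis
      using par[OF f(1) g0(1)] par[OF f0(1) g(1)] par[OF f(1) g(1)] f g f0 g0
        order_0_eq_0_iff[of "frm p f"] order_0_eq_0_iff[of "frm q g"]
        order_0_eq_0_iff[of "frm p f0"] order_0_eq_0_iff[of "frm q g0"] by auto
  qed
qed

end

section \<open>Factorizations of the powers of the ideal\<close>

context two_variables
begin

abbreviation cst :: "'a \<Rightarrow> ('n, 'a) mpoly_ring" where "cst c \<equiv> Poly_Mapping.single 0 c"

text \<open>The forms of \<open>S d\<close> and \<open>A c\<close> have orders in \<^term>\<open>t\<close> that are zero or odd, while the
  products \<open>M 1 \<cdot> S d\<close> (\<^term>\<open>d\<close> odd) and \<open>A c \<cdot> S d\<close> (\<^term>\<open>d\<close> odd, \<^term>\<open>c\<close> a unit) are powers of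
  \<open>M 1\<close>: together they write every \<open>M k\<close> with \<open>k \<ge> 2\<close> as a product of two atoms.\<close>

definition S :: "nat \<Rightarrow> ('n, 'a) mpoly_ring set" where
  "S d = gen_ideal {X ^ (d - l) * Y ^ l | l. l \<le> d \<and> (l = 0 \<or> odd l)}"

definition A :: "'a \<Rightarrow> ('n, 'a) mpoly_ring set" where
  "A c = gen_ideal {X ^ 2 + cst c * Y ^ 2, X * Y}"

lemma is_ideal_S: "is_ideal (S d)" and is_ideal_A: "is_ideal (A c)"
  unfolding S_def A_def by (rule is_ideal_gen_ideal)+

lemma monomial_in_S: "l \<le> d \<Longrightarrow> l = 0 \<or> odd l \<Longrightarrow> X ^ (d - l) * Y ^ l \<in> S d"
  unfolding S_def by (rule subsetD[OF gen_ideal_superset]) blast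

lemma square_in_A: "X ^ 2 + cst c * Y ^ 2 \<in> A c" and mixed_in_A: "X * Y \<in> A c"
  unfolding A_def using gen_ideal_superset by blast+

lemma S_subset: "S d \<subseteq> {f \<in> M d. frm d f \<in> {F. \<forall>l. l \<noteq> 0 \<and> even l \<longrightarrow> coeff F l = 0}}"
  unfolding S_def
proof (rule gen_ideal_least)
  show "{X ^ (d - l) * Y ^ l | l. l \<le> d \<and> (l = 0 \<or> odd l)} \<subseteq>
      {f \<in> M d. frm d f \<in> {F. \<forall>l. l \<noteq> 0 \<and> even l \<longrightarrow> coeff F l = 0}}"
  proof clarify
    fix l assume l: "l \<le> d" "l = 0 \<or> odd l"
    have "X ^ (d - l) * Y ^ l \<in> M d" unfolding monomial_in_M_iff using l by simp
    moreover have "frm d (X ^ (d - l) * Y ^ l) = monom 1 l" unfolding frm_monomial using l by simp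
    ultimately show "X ^ (d - l) * Y ^ l \<in> M d \<and>
        frm d (X ^ (d - l) * Y ^ l) \<in> {F. \<forall>l. l \<noteq> 0 \<and> even l \<longrightarrow> coeff F l = 0}"
      using l by auto
  qed
qed (rule is_ideal_forms_in; auto)

lemma S_1: "S 1 = M 1"
proof (rule antisym)
  show "S 1 \<subseteq> M 1" using S_subset by auto
  show "M 1 \<subseteq> S 1"
  proof (rule M_least[OF is_ideal_S])
    fix l :: nat assume "l \<le> 1"
    hence "l = 0 \<or> l = 1" by auto
    thus "X ^ (1 - l) * Y ^ l \<in> S 1" using monomial_in_S[of l 1] by auto
  qed
qed

lemma M_1_mult_S:
  assumes d: "odd d"
  shows "ideal_prod (M 1) (S d) = M (d + 1)"
proof (rule antisym)
  have "S d \<subseteq> M d" using S_subset by auto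
  thus "ideal_prod (M 1) (S d) \<subseteq> M (d + 1)"
    using ideal_prod_mono[OF order_refl, of "S d" "M d" "M 1"] M_prod[of 1 d] by (simp add: add.commute)
  have XM: "X \<in> M 1" and YM: "Y \<in> M 1"
    using monomial_in_M_iff[of 1 0 1] monomial_in_M_iff[of 0 1 1] by simp_all
  show "M (d + 1) \<subseteq> ideal_prod (M 1) (S d)"
  proof (rule M_least[OF is_ideal_prod])
    fix l assume l: "l \<le> d + 1"
    \<comment> \<open>Exponents that are zero or odd need a factor \<open>X\<close>, positive even
      ones a factor \<open>Y\<close>; as \<open>d\<close> is odd, \<open>l = d + 1\<close> belongs
      to the second case.\<close>
    consider "l \<le> d" "l = 0 \<or> odd l" | k where "l = Suc k" "k \<le> d" "odd k"
      using l d by (cases l) (auto simp: le_Suc_eq)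
    thus "X ^ (d + 1 - l) * Y ^ l \<in> ideal_prod (M 1) (S d)"
    proof cases
      case 1
      hence eq: "X ^ (d + 1 - l) * Y ^ l = X * (X ^ (d - l) * Y ^ l)"
        by (simp add: Suc_diff_le mult.assoc)
      show ?thesis unfolding eq by (rule ideal_prod_memI[OF XM monomial_in_S[OF 1]])
    next
      case (2 k)
      hence eq: "X ^ (d + 1 - l) * Y ^ l = Y * (X ^ (d - k) * Y ^ k)" by (simp add: ac_simps)
      show ?thesis unfolding eq using 2 by (intro ideal_prod_memI YM monomial_in_S) auto
    qed
  qed
qed

lemma frm_square:
  "frm d (X ^ 2 + cst c * Y ^ 2) = (if d = 2 then 1 + monom (Poly_Mapping.single 0 c) 2 else 0)"
proof -
  have "frm d (X ^ 2) = (if d = 2 then 1 else 0)" using frm_monomial[of d 2 0] by simp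
  moreover have "frm d (cst c * Y ^ 2) = (if d = 2 then monom (Poly_Mapping.single 0 c) 2 else 0)"
    by (simp add: form_def bigrading_mult bigrading_single rest_zero mult_monom bigrading_power
        bigrading_var_right[OF ij] monom_power, simp add: numeral_2_eq_2)
  ultimately show ?thesis by (simp add: form_add)
qed

text \<open>The relation excludes forms of order exactly 2, which makes \<open>A c\<close> an atom
  for a unit \<open>c\<close>, and it also determines \<open>c\<close>.\<close>

lemma A_subset: "A c \<subseteq> {f \<in> M 2. frm 2 f \<in> {F. coeff F 2 = Poly_Mapping.single 0 c * coeff F 0}}"
  unfolding A_def
proof (rule gen_ideal_least)
  have "X ^ 2 + cst c * Y ^ 2 \<in> M 2" by (simp add: order_ideal_def frm_square)
  moreover have "X * Y \<in> M 2" "frm 2 (X * Y) = monom 1 1"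
    using monomial_in_M_iff[of 1 1 2] frm_monomial[of 2 1 1] by simp_all
  ultimately show "{X ^ 2 + cst c * Y ^ 2, X * Y} \<subseteq>
      {f \<in> M 2. frm 2 f \<in> {F. coeff F 2 = Poly_Mapping.single 0 c * coeff F 0}}"
    by (simp add: frm_square)
qed (rule is_ideal_forms_in; simp add: algebra_simps)

text \<open>Odd exponents of \<open>Y\<close> are reached by induction in steps of two, dividing by
  the unit \<open>c\<close>; positive even ones are \<open>X * Y\<close> times a monomial with odd
  exponent; exponent 0 follows from exponent 2.\<close>

lemma A_mult_S:
  assumes d: "odd d" and c: "c dvd 1"
  shows "ideal_prod (A c) (S d) = M (d + 2)"
proof (rule antisym)
  have "S d \<subseteq> M d" "A c \<subseteq> M 2" using S_subset A_subset by auto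
  thus "ideal_prod (A c) (S d) \<subseteq> M (d + 2)"
    using ideal_prod_mono[of "A c" "M 2" "S d" "M d"] M_prod[of 2 d] by (simp add: add.commute)
  obtain b where b: "1 = c * b" using c by (auto elim: dvdE)
  have cb: "cst b * cst c = 1" using b by (simp add: mult_single mult.commute)
  let ?P = "ideal_prod (A c) (S d)"
  have odd_step: "X ^ (d + 2 - l) * Y ^ l \<in> ?P" if "odd l" "l \<le> d + 2" for l
    using that
  proof (induction l rule: less_induct)
    case (less l)
    show ?case
    proof (cases "l = 1")
      case True
      have "X * Y * (X ^ (d - 0) * Y ^ 0) \<in> ?P"
        by (intro ideal_prod_memI mixed_in_A monomial_in_S) auto
      thus ?thesis using True by (simp add: ac_simps)
    next
      case False
      define k where "k = l - 2"
      have k: "l = k + 2" "odd k" "k \<le> d"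
        using less.prems False by (auto simp: k_def elim!: oddE)
      have "(X ^ 2 + cst c * Y ^ 2) * (X ^ (d - k) * Y ^ k) \<in> ?P"
        using k by (intro ideal_prod_memI square_in_A monomial_in_S) auto
      moreover have "X ^ (d + 2 - k) * Y ^ k \<in> ?P" using less.IH[of k] k by simp
      ultimately have "cst b * ((X ^ 2 + cst c * Y ^ 2) * (X ^ (d - k) * Y ^ k) - X ^ (d + 2 - k) * Y ^ k) \<in> ?P"
        by (rule is_ideal_mult[OF is_ideal_prod is_ideal_diff[OF is_ideal_prod]])
      also have "X ^ (d + 2 - k) = X ^ 2 * X ^ (d - k)"
        using k by (simp add: Suc_diff_le power2_eq_square mult.assoc)
      also have "cst b * ((X ^ 2 + cst c * Y ^ 2) * (X ^ (d - k) * Y ^ k) - X ^ 2 * X ^ (d - k) * Y ^ k) =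
          (cst b * cst c) * (X ^ (d - k) * (Y ^ k * Y ^ 2))"
        by (simp add: algebra_simps)
      also have "\<dots> = X ^ (d + 2 - l) * Y ^ l" unfolding cb using k by (simp flip: power_add)
      finally show ?thesis .
    qed
  qed
  have even_step: "X ^ (d + 2 - l) * Y ^ l \<in> ?P" if l: "even l" "l \<le> d + 2" "l \<noteq> 0" for l
  proof -
    obtain k where k: "l = Suc k" using l by (cases l) auto
    \<comment> \<open>\<open>d + 2\<close> is odd, so the even \<open>l\<close> is at most
      \<open>d + 1\<close>.\<close>
    have "k \<le> d" using l d k by (auto simp: le_Suc_eq)
    have "X * Y * (X ^ (d - k) * Y ^ k) \<in> ?P"
      using l k \<open>k \<le> d\<close> by (intro ideal_prod_memI mixed_in_A monomial_in_S) auto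
    moreover have "X ^ (d + 2 - l) = X * X ^ (d - k)" using k \<open>k \<le> d\<close> by (simp add: Suc_diff_le)
    ultimately show ?thesis using k by (simp add: ac_simps)
  qed
  have zero_step: "X ^ (d + 2) \<in> ?P"
  proof -
    have "(X ^ 2 + cst c * Y ^ 2) * (X ^ (d - 0) * Y ^ 0) - cst c * (X ^ (d + 2 - 2) * Y ^ 2) \<in> ?P"
      by (rule is_ideal_diff[OF is_ideal_prod
          ideal_prod_memI[OF square_in_A monomial_in_S] is_ideal_mult[OF is_ideal_prod even_step]]) auto
    thus ?thesis by (simp add: algebra_simps power2_eq_square)
  qed
  show "M (d + 2) \<subseteq> ?P"
    by (rule M_least[OF is_ideal_prod]) (metis odd_step even_step zero_step diff_zero power_0 mult_1_right)
qed

text \<open>In the criterion \<open>X ^ d\<close> supplies both the constant coefficient and the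
  monomial form, and \<open>Y ^ d\<close> the top coefficient; the latter lies in \<open>S d\<close>
  because \<open>d\<close> is odd.\<close>

lemma atom_S:
  assumes d: "odd d"
  shows "atom G (S d)"
proof (rule atom_by_forms[OF is_ideal_S, where u = "X ^ (d - 0) * Y ^ 0" and t = 1
      and v = "X ^ (d - d) * Y ^ d" and w = "X ^ (d - 0) * Y ^ 0" and c = 1 and l = 0])
  show "S d \<subseteq> M d" using S_subset by auto
  show "d \<noteq> 0" using d by (cases d) auto
  show "ideal_prod (S d) (M 1) = M (d + 1)" using M_1_mult_S[OF d] ideal_prod_commute by metis
  fix f assume "f \<in> S d" "frm d f \<noteq> 0"
  hence "\<forall>l. l \<noteq> 0 \<and> even l \<longrightarrow> coeff (frm d f) l = 0"
    "coeff (frm d f) (Polynomial.order 0 (frm d f)) \<noteq> 0"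
    using S_subset[of d] coeff_order_0(1) by auto
  thus "Polynomial.order 0 (frm d f) = 0 \<or> odd (Polynomial.order 0 (frm d f))" by blast
next
  have X: "frm d (X ^ (d - 0) * Y ^ 0) = monom 1 0" unfolding frm_monomial by simp
  show "X ^ (d - 0) * Y ^ 0 \<in> S d" "X ^ (d - 0) * Y ^ 0 \<in> S d" by (rule monomial_in_S; simp)+
  show "frm d (X ^ (d - 0) * Y ^ 0) = monom 1 0" "coeff (frm d (X ^ (d - 0) * Y ^ 0)) 0 \<noteq> 0"
    unfolding X by simp_all
  show "X ^ (d - d) * Y ^ d \<in> S d" using d by (intro monomial_in_S) auto
  show "coeff (frm d (X ^ (d - d) * Y ^ d)) d \<noteq> 0" unfolding frm_monomial by simp
qed simp

lemma atom_M_1: "atom G (M 1)"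
  using atom_S[of 1] S_1 by simp

lemma A_mult_M_1: "c dvd 1 \<Longrightarrow> ideal_prod (A c) (M 1) = M 3"
  using A_mult_S[of 1 c] S_1 by (simp add: numeral_3_eq_3)

lemma atom_A:
  assumes c: "c dvd 1"
  shows "atom G (A c)"
proof (rule atom_by_forms[OF is_ideal_A])
  show "A c \<subseteq> M 2" using A_subset by auto
  show "ideal_prod (A c) (M 1) = M (2 + 1)" using A_mult_M_1[OF c] by simp
  fix f assume f: "f \<in> A c" "frm 2 f \<noteq> 0"
  let ?n = "Polynomial.order 0 (frm 2 f)"
  have n: "coeff (frm 2 f) ?n \<noteq> 0" by (rule coeff_order_0(1)[OF f(2)])
  have "?n \<le> 2" using le_degree[OF n] degree_form[of i j 2 f] by simp
  \<comment> \<open>A form of order 2 has constant coefficient zero, so the relation in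
    \<open>A_subset\<close> kills its coefficient of degree 2 as well.\<close>
  moreover have "?n \<noteq> 2"
  proof
    assume "?n = 2"
    moreover from this have "coeff (frm 2 f) 0 = 0" using coeff_order_0(2)[OF f(2), of 0] by simp
    ultimately show False using n A_subset[of c] f(1) by auto
  qed
  ultimately have "?n = 0 \<or> ?n = 1" by linarith
  thus "?n = 0 \<or> odd ?n" by auto
next
  have "c \<noteq> 0" using c by auto
  hence "(Poly_Mapping.single 0 c :: (nat, 'a) mpoly_ring) \<noteq> 0" by (metis lookup_single_eq lookup_zero)
  thus "coeff (frm 2 (X ^ 2 + cst c * Y ^ 2)) 0 \<noteq> 0" "coeff (frm 2 (X ^ 2 + cst c * Y ^ 2)) 2 \<noteq> 0"
    unfolding frm_square by simp_all
  show "frm 2 (X * Y) = monom 1 1" using frm_monomial[of 2 1 1] by simp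
qed (simp_all add: square_in_A mixed_in_A)

lemma inj_A: "inj A"
proof
  fix b c assume "A b = A c"
  hence "X ^ 2 + cst b * Y ^ 2 \<in> A c" using square_in_A[of b] by simp
  hence "Poly_Mapping.single 0 b = (Poly_Mapping.single 0 c :: (nat, 'a) mpoly_ring)"
    using A_subset[of c] by (auto simp: frm_square)
  thus "b = c" by (metis lookup_single_eq)
qed

section \<open>Sets of lengths of the powers\<close>

lemma M_1_pow: "M 1 [^]\<^bsub>G\<^esub> (n :: nat) = M n"
proof (induction n)
  case 0
  thus ?case by (simp add: one_ideal_monoid order_ideal_0)
next
  case (Suc n)
  thus ?case by (simp add: mult_ideal_monoid M_prod)
qed

lemma mprod_replicate_M_1: "mprod G (replicate n (M 1) @ us) = ideal_prod (M n) (mprod G us)"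
  if "set us \<subseteq> carrier G"
proof (induction n)
  case 0
  have "is_ideal (mprod G us)" using mprod_closed[OF that] by (rule carrier_is_ideal)
  thus ?case by (simp add: order_ideal_0 ideal_prod_UNIV)
next
  case (Suc n)
  have "mprod G (replicate (Suc n) (M 1) @ us) = ideal_prod (M 1) (mprod G (replicate n (M 1) @ us))"
    by (simp add: mprod_def mult_ideal_monoid)
  thus ?case unfolding Suc by (simp add: M_prod flip: ideal_prod_assoc)
qed

text \<open>Even \<open>k\<close> takes \<open>M 1\<close> and \<open>S (k - 1)\<close>, odd
  \<open>k\<close> takes \<open>A 1\<close> and \<open>S (k - 2)\<close>.\<close>

lemma M_product_of_two_atoms:
  assumes "2 \<le> k"
  shows "\<exists>u v. atom G u \<and> atom G v \<and> ideal_prod u v = M k"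
proof (cases "even k")
  case True
  hence "odd (k - 1)" "k = (k - 1) + 1" using assms by auto
  thus ?thesis using atom_M_1 atom_S M_1_mult_S by metis
next
  case False
  hence "k \<noteq> 2" by auto
  hence "odd (k - 2)" "k = (k - 2) + 2" using assms False by auto
  thus ?thesis using atom_A[of 1] atom_S A_mult_S[of "k - 2" 1] by (metis dvd_refl)
qed

lemma not_atom_M:
  assumes "2 \<le> k"
  shows "\<not> atom G (M k)"
proof
  assume "atom G (M k)"
  moreover have "M k = M 1 \<otimes>\<^bsub>G\<^esub> M (k - 1)" using M_prod[of 1 "k - 1"] assms by (simp add: mult_ideal_monoid)
  ultimately have "M 1 = UNIV \<or> M (k - 1) = UNIV"
    using atomD[OF _ M_closed M_closed, of 1 "k - 1"] by (simp add: one_ideal_monoid)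
  thus False using assms by (simp add: M_eq_UNIV_iff)
qed

lemma mprod_subset_M:
  "\<forall>u\<in>set us. u \<subseteq> M 1 \<Longrightarrow> mprod G us \<subseteq> M (length us)"
proof (induction us)
  case Nil
  thus ?case by (simp add: order_ideal_0)
next
  case (Cons u us)
  hence "ideal_prod u (mprod G us) \<subseteq> ideal_prod (M 1) (M (length us))"
    by (intro ideal_prod_mono) auto
  thus ?case by (simp add: M_prod mprod_def mult_ideal_monoid)
qed

lemma lengths_M:
  assumes k: "2 \<le> k"
  shows "lengths G (M k) = {2..k}"
proof (intro antisym subsetI)
  fix n assume n: "n \<in> lengths G (M k)"
  then obtain us where us: "set us \<subseteq> {u. atom G u}" "M k = mprod G us" "n = length us"
    unfolding lengths_eq by auto
  note ucl = atoms_closed[OF us(1)]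
  have "u \<subseteq> M 1" if u: "u \<in> set us" for u
  proof (rule ccontr)
    assume nsub: "\<not> u \<subseteq> M 1"
    have cl: "mprod G (remove1 u us) \<in> carrier G"
      using mprod_closed[of "remove1 u us"] set_remove1_subset[of u us] ucl by blast
    have "ideal_prod u (mprod G (remove1 u us)) = M k"
      using mprod_remove1[OF ucl u] us(2) by (simp add: mult_ideal_monoid)
    moreover have "u \<in> carrier G" "atom G u" using ucl us(1) u by auto
    ultimately show False
      using factor_M_eq_UNIV[OF _ cl _ nsub, of k] atom_not_one[of u] by (simp add: one_ideal_monoid)
  qed
  hence "M k \<subseteq> M n" using mprod_subset_M[of us] us by simp
  moreover have "X ^ k * Y ^ 0 \<in> M k" unfolding monomial_in_M_iff by simp
  ultimately have "X ^ k * Y ^ 0 \<in> M n" by blast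
  hence "n \<le> k" unfolding monomial_in_M_iff by simp
  moreover have "0 \<notin> lengths G (M k)"
    using zero_in_lengths_iff[of "M k"] k by (simp add: one_ideal_monoid M_eq_UNIV_iff)
  hence "n \<noteq> 0" using n by metis
  moreover have "n \<noteq> 1" using n one_in_lengths_iff[of "M k"] not_atom_M[OF k] by metis
  ultimately show "n \<in> {2..k}" by simp
next
  fix n assume n: "n \<in> {2..k}"
  \<comment> \<open>The \<open>n - 2\<close> copies of \<open>M 1\<close> contribute order
    \<open>n - 2\<close>, which leaves \<open>M (k - n + 2)\<close> for the two further
    atoms.\<close>
  obtain u v where uv: "atom G u" "atom G v" "ideal_prod u v = M (k - n + 2)"
    using M_product_of_two_atoms[of "k - n + 2"] by auto
  let ?us = "replicate (n - 2) (M 1) @ [u, v]"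
  have "mprod G [u, v] = M (k - n + 2)"
    using uv atom_closed[of v] by (simp add: mprod_def flip: mult_ideal_monoid)
  moreover have "set [u, v] \<subseteq> carrier G" using uv atom_closed by auto
  moreover have "n - 2 + (k - n + 2) = k" using n unfolding atLeastAtMost_iff by linarith
  ultimately have "mprod G ?us = M k" by (simp only: mprod_replicate_M_1 M_prod)
  moreover have "length ?us \<in> lengths G (mprod G ?us)"
    by (rule lengthsI) (use uv atom_M_1 in auto)
  moreover have "length ?us = n" using n by auto
  ultimately show "n \<in> lengths G (M k)" by (simp only:)
qed

text \<open>Grading with \<open>i = j\<close> turns the multiples of \<^term>\<open>Y\<close> into the elements without form of
  degree zero, and the form of degree zero is multiplicative.\<close>

lemma principal_eq: "range ((*) Y) = order_ideal j j 1"
proof (intro antisym subsetI)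
  fix f assume "f \<in> range ((*) Y)"
  then obtain g where f: "f = Y * g" by auto
  have "form j j 0 Y = 0" unfolding var_def by (simp add: form_single)
  thus "f \<in> order_ideal j j 1" unfolding f order_ideal_def by (simp add: form_mult)
next
  fix f :: "('n, 'a) mpoly_ring" assume f: "f \<in> order_ideal j j 1"
  have idl: "is_ideal (range ((*) Y))"
    unfolding is_ideal_def
    by (auto simp: image_iff intro: exI[of _ 0]) (metis distrib_left, metis mult.left_commute)
  have "Poly_Mapping.single e (lookup f e) \<in> range ((*) Y)" if e: "e \<in> keys f" for e
  proof -
    \<comment> \<open>With both indices equal to \<open>j\<close> the degree is twice the exponent
      of \<open>Y\<close>, so degree at least 1 means a positive exponent.\<close>
    have "1 \<le> lookup e j" using mem_order_ideal_keys[OF f e] by auto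
    then obtain g where "Poly_Mapping.single e (lookup f e) = g * (X ^ 0 * Y ^ 1)"
      using single_divisible[OF ij, of 0 e 1] by auto
    thus ?thesis by (simp add: mult.commute)
  qed
  hence "(\<Sum>e\<in>keys f. Poly_Mapping.single e (lookup f e)) \<in> range ((*) Y)"
    by (rule is_ideal_sum[OF idl])
  thus "f \<in> range ((*) Y)" unfolding sum_single_lookup .
qed

definition P :: "('n, 'a) mpoly_ring set" where "P = range ((*) Y)"

lemma is_ideal_P: "is_ideal P"
  unfolding P_def principal_eq by (rule is_ideal_order_ideal)

lemma P_prime: "f * g \<in> P \<Longrightarrow> f \<in> P \<or> g \<in> P"
  unfolding P_def principal_eq order_ideal_def by (auto simp: form_mult)

lemma P_mult:
  assumes I: "is_ideal I"
  shows "ideal_prod P I = (*) Y ` I"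
proof (rule antisym)
  have "is_ideal ((*) Y ` I)"
    unfolding is_ideal_def
  proof (intro conjI ballI allI)
    show "0 \<in> (*) Y ` I" using is_ideal_zero[OF I] by force
    show "f + g \<in> (*) Y ` I" if "f \<in> (*) Y ` I" "g \<in> (*) Y ` I" for f g
      using that is_ideal_add[OF I] by (auto simp flip: distrib_left)
    show "r * f \<in> (*) Y ` I" if f: "f \<in> (*) Y ` I" for r f
    proof -
      obtain g where "g \<in> I" "f = Y * g" using f by auto
      hence "r * f = Y * (r * g)" "r * g \<in> I" by (simp_all add: mult.left_commute is_ideal_mult[OF I])
      thus ?thesis by blast
    qed
  qed
  thus "ideal_prod P I \<subseteq> (*) Y ` I"
    by (rule ideal_prod_least) (auto simp: P_def mult.assoc intro: is_ideal_mult[OF I])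
  have "Y \<in> P" unfolding P_def using rangeI[of "(*) Y" 1] by simp
  thus "(*) Y ` I \<subseteq> ideal_prod P I" by (auto intro: ideal_prod_memI)
qed

lemma Y_neq_0: "Y \<noteq> 0"
  using monomial_neq_0[of 0 1] by simp

lemma inj_mult_Y: "inj ((*) Y)"
proof
  fix f g assume "Y * f = Y * g"
  hence "Y * (f - g) = 0" by (simp add: algebra_simps)
  thus "f = g" using mpoly_no_zero_divisors Y_neq_0 by fastforce
qed

lemma P_closed: "P \<in> carrier G"
  by (rule carrierI[OF is_ideal_P _ Y_neq_0]) (auto simp: P_def intro: rev_image_eqI[of 1])

lemma P_neq_UNIV: "P \<noteq> UNIV"
proof
  assume "P = UNIV"
  hence "(1 :: ('n, 'a) mpoly_ring) \<in> order_ideal j j 1" using principal_eq by (simp add: P_def)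
  thus False by (simp add: order_ideal_def form_def bigrading_one)
qed

text \<open>For a principal ideal containment gives divisibility: dividing every element of
  \<open>I\<close> by \<open>Y\<close> yields the cofactor.\<close>

lemma P_divides:
  assumes I: "I \<in> carrier G" and sub: "I \<subseteq> P"
  shows "P divides\<^bsub>G\<^esub> I"
proof -
  let ?J = "{g. Y * g \<in> I}"
  have "is_ideal ?J" using is_ideal_colon[OF carrier_is_ideal[OF I], of "{Y}"] by simp
  moreover have img: "(*) Y ` ?J = I" using sub by (auto simp: P_def)
  moreover have "?J \<noteq> {0}" using img I by (auto simp: carrier_ideal_monoid)
  ultimately have "?J \<in> carrier G" "I = P \<otimes>\<^bsub>G\<^esub> ?J"
    by (simp_all add: ideal_monoid_simps P_mult)
  thus ?thesis by (rule dividesI)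
qed

text \<open>Elements of \<open>I\<close> and \<open>J\<close> outside \<open>P\<close> have a
  product outside \<open>P\<close>, whereas every multiple of \<open>P\<close> is contained in
  \<open>P\<close>.\<close>

lemma P_divides_prod:
  assumes I: "I \<in> carrier G" and J: "J \<in> carrier G" and div: "P divides\<^bsub>G\<^esub> I \<otimes>\<^bsub>G\<^esub> J"
  shows "P divides\<^bsub>G\<^esub> I \<or> P divides\<^bsub>G\<^esub> J"
proof (rule ccontr)
  assume "\<not> ?thesis"
  then obtain f g where fg: "f \<in> I" "f \<notin> P" "g \<in> J" "g \<notin> P"
    using P_divides[OF I] P_divides[OF J] by blast
  obtain K where "ideal_prod I J = ideal_prod P K"
    using div unfolding factor_def mult_ideal_monoid by blast
  hence "ideal_prod I J \<subseteq> P" using ideal_prod_subset_left[OF is_ideal_P, of K] by simp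
  thus False using ideal_prod_memI[OF fg(1,3)] P_prime[of f g] fg by blast
qed

lemma lengths_P_mult:
  assumes I: "I \<in> carrier G"
  shows "lengths G (P \<otimes>\<^bsub>G\<^esub> I) = Suc ` lengths G I"
proof (rule lengths_prime_mult[OF P_closed _ P_divides_prod _ I])
  show "P \<noteq> \<one>\<^bsub>G\<^esub>" using P_neq_UNIV by (simp add: one_ideal_monoid)
  fix I J assume "I \<in> carrier G" "J \<in> carrier G" "P \<otimes>\<^bsub>G\<^esub> I = P \<otimes>\<^bsub>G\<^esub> J"
  thus "I = J"
    using inj_image_eq_iff[OF inj_mult_Y, of I J] carrier_is_ideal
    by (simp add: mult_ideal_monoid P_mult)
qed

text \<open>The ideal is \<open>M k\<close> multiplied \<open>r\<close> times by \<open>P\<close>,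
  each factor shifting the lengths by one.\<close>

lemma ex_lengths_shifted:
  "2 \<le> k \<Longrightarrow> \<exists>I\<in>carrier G. lengths G I = {r + 2..r + k}"
proof (induction r)
  case 0
  thus ?case using M_closed lengths_M by (metis add_0)
next
  case (Suc r)
  then obtain I where I: "I \<in> carrier G" "lengths G I = {r + 2..r + k}" by blast
  hence "lengths G (P \<otimes>\<^bsub>G\<^esub> I) = {Suc r + 2..Suc r + k}"
    using lengths_P_mult[OF I(1)] by (simp add: image_Suc_atLeastAtMost)
  thus ?case using m_closed[OF P_closed I(1)] by blast
qed

section \<open>Failure of the Krull and finiteness properties\<close>

lemma not_transfer_Krull:
  "\<not> (\<exists>(B :: 'b monoid) \<theta> (F :: 'c monoid) \<phi>. transfer_hom G B \<theta> \<and> krull_monoid_via B F \<phi>)"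
proof clarify
  fix B :: "'b monoid" and \<theta> and F :: "'c monoid" and \<phi>
  assume \<theta>: "transfer_hom G B \<theta>" and "krull_monoid_via B F \<phi>"
  hence B: "comm_monoid_cancel B" unfolding krull_monoid_via_def by blast
  \<comment> \<open>Both sides equal \<open>M 3\<close>.\<close>
  have "M 1 \<otimes>\<^bsub>G\<^esub> (M 1 \<otimes>\<^bsub>G\<^esub> M 1) = M 1 \<otimes>\<^bsub>G\<^esub> A 1"
    using A_mult_M_1[of 1] ideal_prod_commute[of "A 1" "M 1"]
    by (simp add: mult_ideal_monoid M_prod numeral_3_eq_3)
  thus False by (rule not_transfer_cancel[OF atom_M_1 atom_A[OF dvd_refl] _ B \<theta>])
qed

lemma not_locally_finitely_generated_ideals: "\<not> locally_finitely_generated G"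
proof (rule not_locally_finitely_generated[OF M_closed[of 1]])
  let ?f = "\<lambda>n. S (2 * n + 1)"
  have "inj ?f"
  proof
    fix m n assume eq: "S (2 * m + 1) = S (2 * n + 1)"
    \<comment> \<open>The element \<open>X ^ d\<close> of \<open>S d\<close> has order
      \<open>d\<close>, so the ideal determines \<open>d\<close>.\<close>
    have *: "d' \<le> d" if "S d = S d'" for d d'
    proof -
      have "X ^ (d - 0) * Y ^ 0 \<in> S d" by (rule monomial_in_S) auto
      hence "X ^ (d - 0) * Y ^ 0 \<in> M d'" using S_subset[of d'] that by auto
      thus ?thesis unfolding monomial_in_M_iff by simp
    qed
    show "m = n" using *[OF eq] *[OF eq[symmetric]] by simp
  qed
  hence "infinite (range ?f)" by (rule range_inj_infinite)
  moreover have "range ?f \<subseteq> {u \<in> divisor_closed_gen G (M 1). atom G u}"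
  proof clarify
    fix n :: nat
    let ?d = "2 * n + 1"
    have a: "atom G (S ?d)" by (rule atom_S) simp
    have "M 1 [^]\<^bsub>G\<^esub> (?d + 1) = S ?d \<otimes>\<^bsub>G\<^esub> M 1"
      unfolding M_1_pow mult_ideal_monoid ideal_prod_commute[of "S ?d"] by (rule M_1_mult_S[symmetric]) simp
    hence "S ?d divides\<^bsub>G\<^esub> M 1 [^]\<^bsub>G\<^esub> (?d + 1)" using M_closed[of 1] by (intro dividesI)
    thus "S ?d \<in> divisor_closed_gen G (M 1) \<and> atom G (S ?d)"
      using a atom_closed[OF a] unfolding divisor_closed_gen_def by blast
  qed
  ultimately show "infinite {u \<in> divisor_closed_gen G (M 1). atom G u}" using finite_subset by blast
qed

lemma not_FF_ideals: "infinite {u :: 'a. u dvd 1} \<Longrightarrow> \<not> FF_monoid G"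
proof (rule not_FF_monoid[OF atom_M_1])
  assume "infinite {u :: 'a. u dvd 1}"
  thus "infinite (A ` {u. u dvd 1})" using inj_A by (simp add: finite_image_iff inj_on_subset)
  show "atom G u" if "u \<in> A ` {u. u dvd 1}" for u using that atom_A by auto
  show "M 1 \<otimes>\<^bsub>G\<^esub> u = M 3" if u: "u \<in> A ` {u. u dvd 1}" for u
  proof -
    obtain c where "c dvd 1" "u = A c" using u by auto
    thus ?thesis using A_mult_M_1[of c] ideal_prod_commute[of "M 1" u] by (simp add: mult_ideal_monoid)
  qed
qed

end

theorem theorem5p1:
  defines "G \<equiv> (ideal_monoid :: ('n::finite, 'a::idom) mpoly_ring set monoid)"
  assumes n2: "card (UNIV :: 'n set) \<ge> 2"
    and BF: "BF_monoid G"
  shows "(\<not> (\<exists>(B :: 'b monoid) \<theta> (F :: 'c monoid) \<phi>. transfer_hom G B \<theta> \<and> krull_monoid_via B F \<phi>))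
       \<and> \<not> locally_finitely_generated G
       \<and> (infinite {u::'a. u dvd 1} \<longrightarrow> \<not> FF_monoid G)
       \<and> (\<forall>k\<ge>2. union_of_sets_of_lengths G k = {2..})
       \<and> (\<forall>k\<ge>2. \<forall>i j. i \<noteq> j \<longrightarrow>
            lengths G (gen_ideal {var i, var j} [^]\<^bsub>G\<^esub> k) = {2..k})
       \<and> fully_elastic G"
proof -
  have tv: "two_variables TYPE('a) i j" if "i \<noteq> j" for i j :: 'n
    using that BF unfolding G_def by unfold_locales
  obtain i j :: 'n where ij: "i \<noteq> j"
    using n2 card_le_Suc0_iff_eq[of "UNIV :: 'n set"] by auto
  interpret two_variables i j "TYPE('a)" by (rule tv[OF ij])
  have "lengths G (gen_ideal {var i, var j} [^]\<^bsub>G\<^esub> k) = {2..k}" if "2 \<le> k" "i \<noteq> j" for k and i j :: 'n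
  proof -
    \<comment> \<open>This pair of variables is arbitrary, independent of the pair fixed
      above.\<close>
    interpret two: two_variables i j "TYPE('a)" by (rule tv[OF that(2)])
    show ?thesis
      unfolding G_def gen_ideal_vars[OF that(2)] two.M_1_pow by (rule two.lengths_M[OF that(1)])
  qed
  moreover have "union_of_sets_of_lengths G k = {2..}" if "2 \<le> k" for k
    unfolding G_def by (rule union_of_sets_of_lengths_eq[OF M_closed lengths_M that])
  ultimately show ?thesis
    unfolding G_def
    using not_transfer_Krull not_locally_finitely_generated_ideals not_FF_ideals
      fully_elasticI[OF ex_lengths_shifted] by blast
qed

end
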